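(* Let $d,d_\theta,n\ge 1$ be integers and $D=2d+d_\theta$. Let $\mathcal B_s=\prod_{i=1}^d[\alpha_i,\beta_i]$, $\Theta=\prod_{i=d+1}^{d+d_\theta}[\alpha_i,\beta_i]$, $\mathcal B_t=\prod_{i=d+d_\theta+1}^{D}[\alpha_i,\beta_i]$ with $\alpha_i<\beta_i$, and $\Xi=\mathcal B_s\times\Theta\times\mathcal B_t=\prod_{i=1}^D[\alpha_i,\beta_i]$. Let $\mathcal X=\{\boldsymbol x_1,\dots,\boldsymbol x_{N_s}\}\subset\mathcal B_s$ and $\mathcal Y=\{\boldsymbol y_1,\dots,\boldsymbol y_{N_t}\}\subset\mathcal B_t$ be finite sets of points. Let $\kappa(\boldsymbol x,\boldsymbol y;\boldsymbol\theta)$ be a real-valued parametric kernel and $f_\kappa(\boldsymbol x,\boldsymbol\theta,\boldsymbol y)=\kappa(\boldsymbol x,\boldsymbol y;\boldsymbol\theta)$ for $(\boldsymbol x,\boldsymbol\theta,\boldsymbol y)\in\Xi$. Assume $f_\kappa\in C^\infty(\Xi)$ and that there exist $C_f\ge 0$, $\gamma_f>0$ and $\sigma\in\mathbb N$, $\sigma\ge1$, such that $$\sup_{\boldsymbol\xi\in\Xi}|\partial_i^{v}f_\kappa(\boldsymbol\xi)|\le\frac{C_f\,(v+\sigma-1)!}{\gamma_f^{v}\,(\sigma-1)!}\qquad\text{for all integers }1\le i\le D,\ v\ge 0 .$$ Let $\boldsymbol{\mathcal M}\in\mathbb R^{n\times\cdots\times n}$ ($D$ modes) be the tensor of values of $f_\kappa$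 on the tensor grid of Chebyshev nodes of $\Xi$ with $n$ nodes per dimension, let $\widehat{\boldsymbol{\mathcal M}}=[\boldsymbol{\mathcal G}_1,\dots,\boldsymbol{\mathcal G}_D]\in\mathbb R^{n\times\cdots\times n}$ be a tensor train (TT) approximation of $\boldsymbol{\mathcal M}$, and let $\boldsymbol S$, $\boldsymbol H(\boldsymbol\theta)$, $\boldsymbol T$ be the matrices of the parametric TT kernel (PTTK) approximation built from $\widehat{\boldsymbol{\mathcal M}}$ (all defined in the context). Then $$\max_{\boldsymbol\theta\in\Theta}\big\|\boldsymbol K(\mathcal X,\mathcal Y;\boldsymbol\theta)-\boldsymbol S\,\boldsymbol H(\boldsymbol\theta)\,\boldsymbol T^{\top}\big\|_C\;\le\;E(n)+\lambda_{n-1}^{D}\,\|\boldsymbol{\mathcal M}-\widehat{\boldsymbol{\mathcal M}}\|_C ,$$ where for integers $k\ge 1$ $$E(k)=2e\,D\,C_f\,(\lambda_{k-1}+1)^D\,(k+1)^{\sigma}\Big(1+\frac{\operatorname{diam}_\infty(\Xi)}{\gamma_f}\Big)\,\varsigma\Big(\frac{2\gamma_f}{\operatorname{diam}_\infty(\Xi)}\Big)^{-k},$$ $\varsigma(r)=r+\sqrt{1+r^2}$, $\operatorname{diam}_\infty(\Xi)=\max_{1\le i\le D}(\beta_i-\alpha_i)$, and $\lambda_{k-1}$ is the Lebesgue constant of the $k$ Chebyshev nodes of the first kind.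
   Context: Norm. $\|\cdot\|_C$ is the maximum absolute value of the entries of a matrix or tensor. Kernel matrix. $\boldsymbol K(\mathcal X,\mathcal Y;\boldsymbol\theta)\in\mathbb R^{N_s\times N_t}$ has entries $\kappa(\boldsymbol x_a,\boldsymbol y_b;\boldsymbol\theta)$. Derivatives. $\partial_i^v$ is the $v$-th order partial derivative in the $i$-th coordinate. Chebyshev nodes and Lebesgue constant. For $k\ge1$, the Chebyshev nodes of the first kind on $[-1,1]$ are the $k$ roots of $T_k(x)=\cos(k\arccos x)$; if $\ell_1,\dots,\ell_k$ are the Lagrange basis polynomials (degree $k-1$) for these nodes, then $\lambda_{k-1}=\max_{x\in[-1,1]}\sum_{j=1}^k|\ell_j(x)|$. Mapped nodes and basis. Let $\zeta_1,\dots,\zeta_n$ be the $n$ Chebyshev nodes, and for $1\le j\le D$ let $\varphi_j(x)=\frac{\alpha_j-\beta_j}{2}x+\frac{\alpha_j+\beta_j}{2}$ (an affine bijection $[-1,1]\to[\alpha_j,\beta_j]$) and $\eta_i^{(j)}=\varphi_j(\zeta_i)$. Define $$\phi_i^{(j)}(x)=\frac1n+\frac2n\sum_{k=1}^{n-1}T_k\big(\zeta_i\big)\,T_k\big(\varphi_j^{-1}(x)\big),\qquad 1\le i\le n .$$ Coefficient tensor. $\boldsymbol{\mathcal M}$ has entries $m_{i_1,\dots,i_D}=f_\kappa(\eta^{(1)}_{i_1},\dots,\eta^{(D)}_{i_D})$, $1\le i_j\le n$. TT format. $[\boldsymbol{\mathcal G}_1,\dots,\boldsymbol{\mathcal G}_D]$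 with cores $\boldsymbol{\mathcal G}_j\in\mathbb R^{r_{j-1}\times n\times r_j}$, $r_0=r_D=1$, denotes the tensor whose $(i_1,\dots,i_D)$ entry is the matrix product $\boldsymbol{\mathcal G}_1(:,i_1,:)\,\boldsymbol{\mathcal G}_2(:,i_2,:)\cdots\boldsymbol{\mathcal G}_D(:,i_D,:)$, where $\boldsymbol{\mathcal G}_j(:,i,:)\in\mathbb R^{r_{j-1}\times r_j}$. PTTK matrices. For $1\le j\le D$ and $t\in[\alpha_j,\beta_j]$ put $\boldsymbol A_j(t)=\sum_{i=1}^n\phi^{(j)}_i(t)\,\boldsymbol{\mathcal G}_j(:,i,:)\in\mathbb R^{r_{j-1}\times r_j}$. Then: - $\boldsymbol S\in\mathbb R^{N_s\times r_d}$ has $a$-th row $\boldsymbol A_1([\boldsymbol x_a]_1)\,\boldsymbol A_2([\boldsymbol x_a]_2)\cdots\boldsymbol A_d([\boldsymbol x_a]_d)$; - $\boldsymbol H(\boldsymbol\theta)=\boldsymbol A_{d+1}(\theta_1)\cdots\boldsymbol A_{d+d_\theta}(\theta_{d_\theta})\in\mathbb R^{r_d\times r_{d+d_\theta}}$; - $\boldsymbol T\in\mathbb R^{N_t\times r_{d+d_\theta}}$ is such that the $b$-th column of $\boldsymbol T^\top$ is $\boldsymbol A_{d+d_\theta+1}([\boldsymbol y_b]_1)\cdots\boldsymbol A_{D}([\boldsymbol y_b]_d)$. Here $[\boldsymbol x]_i$ denotes the $i$-th coordinate of $\boldsymbol x$. *)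

theory Defs
  imports "HOL-Analysis.Analysis" "Jordan_Normal_Form.Matrix"
begin

text \<open>
  A point of \<open>\<real>\<^sup>m\<close> is a function \<open>nat \<Rightarrow> real\<close> in the extensional product over the index set
  \<open>{1..m}\<close>; on such a product the topology of \<open>nat \<Rightarrow> real\<close> is that of \<open>\<real>\<^sup>m\<close>.
  The modes \<open>j\<close> of a tensor and its indices \<open>i\<close> along each mode count from 1.
  Matrices are those of Jordan_Normal_Form, whose rows and columns count from 0.
\<close>

definition box_on :: "nat \<Rightarrow> (nat \<Rightarrow> real) \<Rightarrow> (nat \<Rightarrow> real) \<Rightarrow> (nat \<Rightarrow> real) set" where
  "box_on m \<alpha> \<beta> = (\<Pi>\<^sub>E i\<in>{1..m}. {\<alpha> i..\<beta> i})"

text \<open>The derivative is taken within the closed interval, so it is one-sided on the faces.\<close>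

definition partial_deriv ::
  "(nat \<Rightarrow> real) \<Rightarrow> (nat \<Rightarrow> real) \<Rightarrow> nat \<Rightarrow> ((nat \<Rightarrow> real) \<Rightarrow> real) \<Rightarrow> (nat \<Rightarrow> real) \<Rightarrow> real" where
  "partial_deriv \<alpha> \<beta> i f \<xi> =
     vector_derivative (\<lambda>t. f (\<xi>(i := t))) (at (\<xi> i) within {\<alpha> i..\<beta> i})"

text \<open>
  \<open>C\<^sup>\<infinity>\<close> on the closed box: the iterated partial derivatives in all orders
  (\<open>js\<close> lists the coordinates, \<open>js = []\<close> giving \<open>f\<close> itself) exist on the box, faces included, and
  are continuous there.
\<close>

definition smooth_on_box ::
  "nat \<Rightarrow> (nat \<Rightarrow> real) \<Rightarrow> (nat \<Rightarrow> real) \<Rightarrow> ((nat \<Rightarrow> real) \<Rightarrow> real) \<Rightarrow> bool" where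
  "smooth_on_box m \<alpha> \<beta> f \<longleftrightarrow>
     (\<forall>js. set js \<subseteq> {1..m} \<longrightarrow>
        continuous_on (box_on m \<alpha> \<beta>) (fold (partial_deriv \<alpha> \<beta>) js f) \<and>
        (\<forall>i\<in>{1..m}. \<forall>\<xi>\<in>box_on m \<alpha> \<beta>.
           (\<lambda>t. fold (partial_deriv \<alpha> \<beta>) js f (\<xi>(i := t)))
             differentiable (at (\<xi> i) within {\<alpha> i..\<beta> i})))"

definition diam_inf :: "nat \<Rightarrow> (nat \<Rightarrow> real) \<Rightarrow> (nat \<Rightarrow> real) \<Rightarrow> real" where
  "diam_inf m \<alpha> \<beta> = Max ((\<lambda>i. \<beta> i - \<alpha> i) ` {1..m})"

definition cheb_T :: "nat \<Rightarrow> real \<Rightarrow> real" where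
  "cheb_T k x = cos (real k * arccos x)"

definition cheb_nodes :: "nat \<Rightarrow> real set" where
  "cheb_nodes k = {x \<in> {-1..1}. cheb_T k x = 0}"

text \<open>There are indeed \<open>n\<close> nodes, so that they have an enumeration by \<open>{1..n}\<close>.\<close>

lemma cheb_nodes_bij:
  "bij_betw (\<lambda>i. cos ((2 * real i - 1) * pi / (2 * real n))) {1..n} (cheb_nodes n)"
proof (cases "n = 0")
  case True
  then show ?thesis by (simp add: cheb_nodes_def cheb_T_def bij_betw_def)
next
  case False
  define t where "t = (\<lambda>i::nat. (2 * real i - 1) * pi / (2 * real n))"
  have rng: "0 \<le> t i \<and> t i \<le> pi" if "i \<in> {1..n}" for i
  proof -
    have "2 * real i - 1 \<le> 2 * real n" "0 \<le> 2 * real i - 1" using that by auto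
    then have "(2 * real i - 1) * pi \<le> 2 * real n * pi" by (intro mult_right_mono) auto
    then show ?thesis using False \<open>0 \<le> 2 * real i - 1\<close> by (simp add: t_def field_simps)
  qed
  have nt: "real n * t i = (2 * real i - 1) * pi / 2" for i
    using False by (simp add: t_def)
  have inj: "inj_on (\<lambda>i. cos (t i)) {1..n}"
  proof (rule inj_onI)
    fix i j assume ij: "i \<in> {1..n}" "j \<in> {1..n}" "cos (t i) = cos (t j)"
    then have "t i = t j" using rng cos_inj_pi by blast
    then show "i = j" using False by (simp add: t_def)
  qed
  have "(\<lambda>i. cos (t i)) ` {1..n} = cheb_nodes n"
  proof (intro equalityI subsetI)
    fix x assume "x \<in> (\<lambda>i. cos (t i)) ` {1..n}"
    then obtain i where i: "i \<in> {1..n}" "x = cos (t i)" by blast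
    have "arccos x = t i" using i rng arccos_cos by simp
    moreover have "cos (real n * t i) = 0"
      unfolding nt cos_zero_iff_int
      by (rule exI[of _ "2 * int i - 1"]) simp
    ultimately show "x \<in> cheb_nodes n" using i by (simp add: cheb_nodes_def cheb_T_def)
  next
    fix x assume "x \<in> cheb_nodes n"
    then have x: "-1 \<le> x" "x \<le> 1" and "cos (real n * arccos x) = 0"
      by (auto simp: cheb_nodes_def cheb_T_def)
    then obtain k :: int where k: "odd k" "real n * arccos x = of_int k * (pi / 2)"
      by (auto simp: cos_zero_iff_int)
    have a: "0 \<le> arccos x" "arccos x \<le> pi" using x arccos_lbound arccos_ubound by auto
    have "0 \<le> of_int k * (pi / 2)" using k a by (metis mult_nonneg_nonneg of_nat_0_le_iff)
    then have k0: "0 \<le> k" using pi_gt_zero by (auto simp: zero_le_mult_iff)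
    have "of_int k * (pi / 2) \<le> real n * pi" unfolding k(2)[symmetric] using a by (simp add: mult_left_mono)
    then have "real_of_int k \<le> 2 * real n" by simp
    then have kn: "k \<le> 2 * int n" by linarith
    obtain m where m: "k = 2 * m + 1" using k(1) by (elim oddE)
    define i where "i = nat (m + 1)"
    have i: "i \<in> {1..n}" "k = 2 * int i - 1" using m k0 kn by (auto simp: i_def)
    then have "real n * arccos x = real n * t i" using k(2) by (simp add: nt)
    then have "arccos x = t i" using False by simp
    then show "x \<in> (\<lambda>i. cos (t i)) ` {1..n}" using i x by (metis cos_arccos imageI)
  qed
  then show ?thesis using inj by (simp add: bij_betw_def t_def)
qed

definition lagrange_basis :: "real set \<Rightarrow> real \<Rightarrow> real \<Rightarrow> real" where
  "lagrange_basis Z z x = (\<Prod>w\<in>Z - {z}. (x - w) / (z - w))"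

text \<open>
  As usual, the index is the polynomial degree, one less than the number of nodes. The supremum is
  a maximum, by continuity and compactness.
\<close>

definition lebesgue_const :: "nat \<Rightarrow> real" where
  "lebesgue_const m =
     (SUP x\<in>{-1..1}. \<Sum>z\<in>cheb_nodes (m + 1). \<bar>lagrange_basis (cheb_nodes (m + 1)) z x\<bar>)"

text \<open>Note that \<open>affine_map a b\<close> reverses orientation: it sends \<open>-1\<close> to \<open>b\<close> and \<open>1\<close> to \<open>a\<close>.\<close>

definition affine_map :: "real \<Rightarrow> real \<Rightarrow> real \<Rightarrow> real" where
  "affine_map a b x = (a - b) / 2 * x + (a + b) / 2"

text \<open>
  The basis function \<open>\<phi>\<^sub>i\<close> of the interval \<open>[a, b]\<close>; \<open>\<zeta>\<close> enumerates the nodes as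
  \<open>\<zeta> 1, \<dots>, \<zeta> n\<close>.
\<close>

definition cheb_basis :: "nat \<Rightarrow> (nat \<Rightarrow> real) \<Rightarrow> real \<Rightarrow> real \<Rightarrow> nat \<Rightarrow> real \<Rightarrow> real" where
  "cheb_basis n \<zeta> a b i x =
     1 / real n + 2 / real n *
       (\<Sum>k=1..n - 1. cheb_T k (\<zeta> i) * cheb_T k (inv_into {-1..1} (affine_map a b) x))"

text \<open>Inserting 0 only affects the empty index set.\<close>

definition max_abs :: "'i set \<Rightarrow> ('i \<Rightarrow> real) \<Rightarrow> real" where
  "max_abs I g = Max (insert 0 ((\<lambda>i. \<bar>g i\<bar>) ` I))"

definition mat_norm_C :: "real mat \<Rightarrow> real" where
  "mat_norm_C A = max_abs ({..<dim_row A} \<times> {..<dim_col A}) (\<lambda>ij. A $$ ij)"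

definition tensor_norm_C :: "nat \<Rightarrow> nat \<Rightarrow> ((nat \<Rightarrow> nat) \<Rightarrow> real) \<Rightarrow> real" where
  "tensor_norm_C D n M = max_abs ({1..D} \<rightarrow>\<^sub>E {1..n}) M"

text \<open>The product \<open>A a * A (a + 1) * \<dots> * A b\<close>, where \<open>A b\<close> has \<open>r b\<close> columns.\<close>

definition mat_chain :: "(nat \<Rightarrow> nat) \<Rightarrow> (nat \<Rightarrow> real mat) \<Rightarrow> nat \<Rightarrow> nat \<Rightarrow> real mat" where
  "mat_chain r A a b = foldr (\<lambda>j P. A j * P) [a..<Suc b] (1\<^sub>m (r b))"

text \<open>The core of mode \<open>j\<close> is given by its slices: \<open>G j i\<close> is the matrix \<open>\<G>\<^sub>j(:, i, :)\<close>.\<close>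

definition tt_cores :: "nat \<Rightarrow> nat \<Rightarrow> (nat \<Rightarrow> nat) \<Rightarrow> (nat \<Rightarrow> nat \<Rightarrow> real mat) \<Rightarrow> bool" where
  "tt_cores D n r G \<longleftrightarrow> r 0 = 1 \<and> r D = 1 \<and>
     (\<forall>j\<in>{1..D}. \<forall>i\<in>{1..n}. G j i \<in> carrier_mat (r (j - 1)) (r j))"

definition tt_tensor ::
  "nat \<Rightarrow> (nat \<Rightarrow> nat) \<Rightarrow> (nat \<Rightarrow> nat \<Rightarrow> real mat) \<Rightarrow> (nat \<Rightarrow> nat) \<Rightarrow> real" where
  "tt_tensor D r G idx = mat_chain r (\<lambda>j. G j (idx j)) 1 D $$ (0, 0)"

type_synonym kernel = "(nat \<Rightarrow> real) \<Rightarrow> (nat \<Rightarrow> real) \<Rightarrow> (nat \<Rightarrow> real) \<Rightarrow> real"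

text \<open>
  The argument order is \<open>\<kappa> x y \<theta>\<close>, whereas the coordinates of \<open>kernel_fun\<close> come in the order
  \<open>x, \<theta>, y\<close>.
\<close>

definition kernel_fun :: "nat \<Rightarrow> nat \<Rightarrow> kernel \<Rightarrow> (nat \<Rightarrow> real) \<Rightarrow> real" where
  "kernel_fun d p \<kappa> \<xi> =
     \<kappa> (\<lambda>i\<in>{1..d}. \<xi> i) (\<lambda>i\<in>{1..d}. \<xi> (d + p + i)) (\<lambda>i\<in>{1..p}. \<xi> (d + i))"

definition kernel_mat ::
  "kernel \<Rightarrow> nat \<Rightarrow> nat \<Rightarrow> (nat \<Rightarrow> nat \<Rightarrow> real) \<Rightarrow> (nat \<Rightarrow> nat \<Rightarrow> real) \<Rightarrow> (nat \<Rightarrow> real) \<Rightarrow> real mat" where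
  "kernel_mat \<kappa> N\<^sub>s N\<^sub>t x y \<theta> = Matrix.mat N\<^sub>s N\<^sub>t (\<lambda>(a, b). \<kappa> (x a) (y b) \<theta>)"

definition coeff_tensor ::
  "nat \<Rightarrow> (nat \<Rightarrow> real) \<Rightarrow> (nat \<Rightarrow> real) \<Rightarrow> (nat \<Rightarrow> real) \<Rightarrow> ((nat \<Rightarrow> real) \<Rightarrow> real) \<Rightarrow> (nat \<Rightarrow> nat) \<Rightarrow> real" where
  "coeff_tensor D \<alpha> \<beta> \<zeta> f idx = f (\<lambda>j\<in>{1..D}. affine_map (\<alpha> j) (\<beta> j) (\<zeta> (idx j)))"

text \<open>The matrix \<open>A\<^sub>j(t) = \<Sum>\<^sub>i \<phi>\<^sub>i(t) \<G>\<^sub>j(:, i, :)\<close>, written entrywise.\<close>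

definition pttk_A ::
  "nat \<Rightarrow> (nat \<Rightarrow> real) \<Rightarrow> (nat \<Rightarrow> real) \<Rightarrow> (nat \<Rightarrow> real) \<Rightarrow> (nat \<Rightarrow> nat) \<Rightarrow> (nat \<Rightarrow> nat \<Rightarrow> real mat) \<Rightarrow>
   nat \<Rightarrow> real \<Rightarrow> real mat" where
  "pttk_A n \<alpha> \<beta> \<zeta> r G j t =
     Matrix.mat (r (j - 1)) (r j)
       (\<lambda>pq. \<Sum>i=1..n. cheb_basis n \<zeta> (\<alpha> j) (\<beta> j) i t * G j i $$ pq)"

text \<open>
  In the three definitions below \<open>A\<close> is the family \<open>pttk_A \<dots>\<close>; mode \<open>j\<close> is evaluated at the
  coordinate of the respective point to which it belongs.
\<close>

definition pttk_S ::
  "(nat \<Rightarrow> nat) \<Rightarrow> (nat \<Rightarrow> real \<Rightarrow> real mat) \<Rightarrow> nat \<Rightarrow> nat \<Rightarrow> (nat \<Rightarrow> nat \<Rightarrow> real) \<Rightarrow> real mat" where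
  "pttk_S r A d N\<^sub>s x =
     mat_of_rows (r d) (map (\<lambda>a. Matrix.row (mat_chain r (\<lambda>j. A j (x a j)) 1 d) 0) [0..<N\<^sub>s])"

definition pttk_H ::
  "(nat \<Rightarrow> nat) \<Rightarrow> (nat \<Rightarrow> real \<Rightarrow> real mat) \<Rightarrow> nat \<Rightarrow> nat \<Rightarrow> (nat \<Rightarrow> real) \<Rightarrow> real mat" where
  "pttk_H r A d p \<theta> = mat_chain r (\<lambda>j. A j (\<theta> (j - d))) (d + 1) (d + p)"

definition pttk_T ::
  "(nat \<Rightarrow> nat) \<Rightarrow> (nat \<Rightarrow> real \<Rightarrow> real mat) \<Rightarrow> nat \<Rightarrow> nat \<Rightarrow> nat \<Rightarrow> (nat \<Rightarrow> nat \<Rightarrow> real) \<Rightarrow> real mat" where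
  "pttk_T r A d p N\<^sub>t y =
     transpose_mat (mat_of_cols (r (d + p))
       (map (\<lambda>b. col (mat_chain r (\<lambda>j. A j (y b (j - (d + p)))) (d + p + 1) (2 * d + p)) 0) [0..<N\<^sub>t]))"

definition varsigma :: "real \<Rightarrow> real" where
  "varsigma r = r + sqrt (1 + r\<^sup>2)"

definition cheb_err :: "nat \<Rightarrow> (nat \<Rightarrow> real) \<Rightarrow> (nat \<Rightarrow> real) \<Rightarrow> real \<Rightarrow> real \<Rightarrow> nat \<Rightarrow> nat \<Rightarrow> real" where
  "cheb_err D \<alpha> \<beta> C \<gamma> \<sigma> k =
     2 * exp 1 * real D * C * (lebesgue_const (k - 1) + 1) ^ D * (real k + 1) ^ \<sigma> *
     (1 + diam_inf D \<alpha> \<beta> / \<gamma>) * varsigma (2 * \<gamma> / diam_inf D \<alpha> \<beta>) powi (- int k)"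

end

theory Submission
  imports Defs "HOL-Complex_Analysis.Conformal_Mappings"
begin

text \<open>
  The derivative bounds make every univariate slice of \<open>f\<close> extend holomorphically to the
  \<open>\<gamma>\<close>-neighbourhood of its interval. This neighbourhood contains the Bernstein ellipse whose
  parameter is \<open>varsigma\<close> of the ratio of \<open>\<gamma>\<close> to the half-length of the interval. After the
  Joukowski substitution the extension is holomorphic on an annulus, and cutting the geometric
  series in Cauchy's formula there
  after \<open>n\<close> terms produces a polynomial approximation of degree \<open>n - 1\<close> in the Chebyshev basis. The
  functions \<open>cheb_basis\<close> are the Lagrange basis of the Chebyshev nodes, so univariate interpolation
  loses at most the factor \<open>\<lambda> + 1\<close>; interpolating one coordinate after the other gives the first term
  of the bound. An entry of \<open>S H(\<theta>) T\<^sup>T\<close> is the tensor interpolant with coefficients \<open>M'\<close> in place of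
  \<open>M\<close>, and the weights of the interpolant have absolute sum at most \<open>\<lambda>\<^sup>D\<close>.
\<close>

section \<open>Holomorphic extension\<close>

text \<open>The extension may blow up at the boundary of the \<open>\<gamma>\<close>-neighbourhood:
  the hypotheses only bound it by \<open>C * (1 / (1 - t)) ^ \<sigma>\<close> at distance
  \<open>t * \<gamma>\<close> from the interval. Cauchy's formula is therefore applied not on the
  largest Bernstein ellipse but on the one that reaches the distance \<open>t * \<gamma>\<close>
  with \<open>t = n / (n + 1)\<close>. This choice produces most of the constants:
  \<open>(n + 1) ^ \<sigma>\<close> is the size of the extension there, \<open>exp 1\<close> is the
  loss \<open>(1 + 1 / n) ^ n\<close> caused by the smaller radius, and
  \<open>1 + diam_inf / \<gamma>\<close> bounds \<open>r / (r - 1)\<close>, which measures how close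
  the circles come to the unit circle. The factor 2 counts the two boundary circles of the annulus.
  Each coordinate is interpolated while the others are held fixed, so bounds on pure derivatives
  suffice and holomorphy is only ever used in one variable. Adding up the \<open>D\<close> steps
  gives the factor \<open>D * (\<lambda> + 1) ^ D\<close>. The maximum over \<open>\<Theta>\<close>
  is shown to be attained, which adds a compactness argument to the estimate.\<close>

lemma multichoose_sums:
  fixes t :: real
  assumes "\<bar>t\<bar> < 1" and "\<sigma> \<ge> 1"
  shows "(\<lambda>v. real ((v + \<sigma> - 1) choose v) * t ^ v) sums (1 / (1 - t)) ^ \<sigma>"
proof -
  have "(\<lambda>v. ((- real \<sigma>) gchoose v) * (- t) ^ v) sums (1 + (- t)) powr (- real \<sigma>)"
    using assms by (intro gen_binomial_real) auto
  moreover have "((- real \<sigma>) gchoose v) * (- t) ^ v = real ((v + \<sigma> - 1) choose v) * t ^ v" for v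
  proof -
    have "real \<sigma> + real v - 1 = real (v + \<sigma> - 1)" using assms by auto
    then have "(- real \<sigma>) gchoose v = (- 1) ^ v * real ((v + \<sigma> - 1) choose v)"
      unfolding gbinomial_minus by (simp add: binomial_gbinomial)
    then show ?thesis
      using power_mult_distrib[of "-1::real" "-t" v] by simp
  qed
  moreover have "(1 + (- t)) powr (- real \<sigma>) = (1 / (1 - t)) ^ \<sigma>"
    using assms by (simp add: powr_minus powr_realpow power_one_over inverse_eq_divide)
  ultimately show ?thesis by simp
qed

text \<open>\<open>U v\<close> stands for the derivative of order \<open>v\<close> of the slice
  \<open>U 0\<close>. A family linked by \<open>deriv\<close> accommodates the one-sided derivatives
  at \<open>a\<close> and \<open>b\<close>, and it is the form in which Taylor's theorem on
  \<open>{a..b}\<close> takes its data.\<close>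

locale factorial_derivative_bounds =
  fixes a b C \<gamma> :: real and \<sigma> :: nat and U :: "nat \<Rightarrow> real \<Rightarrow> real"
  assumes ab: "a < b" and C: "C \<ge> 0" and \<gamma>: "\<gamma> > 0" and \<sigma>: "\<sigma> \<ge> 1"
    and deriv: "\<And>v x. x \<in> {a..b} \<Longrightarrow>
      (U v has_field_derivative U (Suc v) x) (at x within {a..b})"
    and bound: "\<And>v x. x \<in> {a..b} \<Longrightarrow>
      \<bar>U v x\<bar> \<le> C * fact (v + \<sigma> - 1) / (\<gamma> ^ v * fact (\<sigma> - 1))"
begin

text \<open>Dividing by \<open>fact v\<close> turns the quotient of factorials into a multichoose
  number. The Taylor series is thus dominated by that of
  \<open>C * (1 / (1 - t)) ^ \<sigma>\<close>, where \<open>t\<close> is the distance to the centre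
  divided by \<open>\<gamma>\<close>; this gives convergence and growth at once.\<close>

lemma coeff_bound:
  assumes "x \<in> {a..b}"
  shows "\<bar>U v x\<bar> / fact v \<le> C * real ((v + \<sigma> - 1) choose v) / \<gamma> ^ v"
proof -
  have "real ((v + \<sigma> - 1) choose v) = fact (v + \<sigma> - 1) / (fact v * fact (\<sigma> - 1))"
    using binomial_fact[of v "v + \<sigma> - 1", where 'a=real] \<sigma> by simp
  then have "C * real ((v + \<sigma> - 1) choose v) / \<gamma> ^ v
      = C * fact (v + \<sigma> - 1) / (\<gamma> ^ v * fact (\<sigma> - 1)) / fact v"
    by simp
  then show ?thesis using divide_right_mono[OF bound[OF assms, of v], of "fact v"] by simp
qed

definition taylor :: "real \<Rightarrow> complex \<Rightarrow> complex" where
  "taylor c z = (\<Sum>v. complex_of_real (U v c / fact v) * (z - complex_of_real c) ^ v)"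

lemma taylor_term_bound:
  assumes "c \<in> {a..b}" and "cmod (z - of_real c) \<le> t * \<gamma>"
  shows "norm (complex_of_real (U v c / fact v) * (z - of_real c) ^ v)
    \<le> C * (real ((v + \<sigma> - 1) choose v) * t ^ v)"
proof -
  have "norm (complex_of_real (U v c / fact v) * (z - of_real c) ^ v)
      = \<bar>U v c\<bar> / fact v * cmod (z - of_real c) ^ v"
    by (simp add: norm_mult norm_power norm_divide)
  also have "\<dots> \<le> C * real ((v + \<sigma> - 1) choose v) / \<gamma> ^ v * (t * \<gamma>) ^ v"
    using assms C \<gamma> by (intro mult_mono coeff_bound power_mono) auto
  also have "\<dots> = C * (real ((v + \<sigma> - 1) choose v) * t ^ v)"
    using \<gamma> by (simp add: power_mult_distrib)
  finally show ?thesis .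
qed

lemma taylor_sums:
  assumes "c \<in> {a..b}" and "cmod (z - of_real c) < \<gamma>"
  shows "(\<lambda>v. complex_of_real (U v c / fact v) * (z - of_real c) ^ v) sums taylor c z"
proof -
  define t where "t = cmod (z - of_real c) / \<gamma>"
  have t: "0 \<le> t" "t < 1" "cmod (z - of_real c) \<le> t * \<gamma>"
    using assms \<gamma> by (auto simp: t_def)
  have "summable (\<lambda>v. C * (real ((v + \<sigma> - 1) choose v) * t ^ v))"
    using multichoose_sums[of t \<sigma>] t \<sigma> by (intro summable_mult) (auto simp: sums_iff)
  then have "summable (\<lambda>v. complex_of_real (U v c / fact v) * (z - of_real c) ^ v)"
    by (rule summable_comparison_test'[of _ 0]) (use taylor_term_bound[OF assms(1) t(3)] in auto)
  then show ?thesis by (simp add: taylor_def summable_sums)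
qed

lemma taylor_norm_le:
  assumes "c \<in> {a..b}" and "cmod (z - of_real c) \<le> t * \<gamma>" and "t < 1"
  shows "cmod (taylor c z) \<le> C * (1 / (1 - t)) ^ \<sigma>"
proof -
  have "0 \<le> t * \<gamma>" using assms(2) by (meson norm_ge_zero order_trans)
  then have t: "0 \<le> t" using \<gamma> by (simp add: zero_le_mult_iff)
  have S: "(\<lambda>v. C * (real ((v + \<sigma> - 1) choose v) * t ^ v)) sums (C * (1 / (1 - t)) ^ \<sigma>)"
    using multichoose_sums[of t \<sigma>] t \<sigma> assms by (intro sums_mult) auto
  show ?thesis
    unfolding taylor_def sums_unique[OF S]
    by (rule norm_suminf_le[OF taylor_term_bound[OF assms(1,2)] sums_summable[OF S]])
qed

lemma taylor_holomorphic:
  assumes "c \<in> {a..b}"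
  shows "taylor c holomorphic_on ball (of_real c) \<gamma>"
  by (rule power_series_holomorphic, rule taylor_sums[OF assms])
    (auto simp: dist_norm norm_minus_commute)

text \<open>Convergence alone does not identify the sum. The remainder in Taylor's theorem is
  dominated by the general term of the differentiated multichoose series at some
  \<open>t < 1\<close>, hence tends to 0.\<close>

lemma taylor_of_real:
  assumes c: "c \<in> {a..b}" and x: "x \<in> {a..b}" and "\<bar>x - c\<bar> < \<gamma>"
  shows "taylor c (of_real x) = of_real (U 0 x)"
proof -
  define t where "t = \<bar>x - c\<bar> / \<gamma>"
  have t: "0 \<le> t" "t < 1" "\<bar>x - c\<bar> = t * \<gamma>"
    using assms \<gamma> by (auto simp: t_def)
  \<comment> \<open>The remainder bound of \<open>field_Taylor\<close> divides by
    \<open>fact n\<close> and not by \<open>fact (Suc n)\<close>. This leaves the factor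
    \<open>Suc v\<close>, and \<open>R v\<close> is \<open>C * t\<close> times a term of the
    \<open>diffs\<close> series.\<close>
  define R where "R v = C * (real (Suc v) * (real ((Suc v + \<sigma> - 1) choose Suc v) * t ^ Suc v))" for v
  have "summable (\<lambda>v. real ((v + \<sigma> - 1) choose v) * y ^ v)" if "\<bar>y\<bar> < 1" for y
    using multichoose_sums[of y \<sigma>] that \<sigma> by (simp add: sums_iff)
  then have "summable (\<lambda>v. diffs (\<lambda>v. real ((v + \<sigma> - 1) choose v)) v * t ^ v)"
    using t by (intro termdiff_converges[where K=1]) auto
  then have "(\<lambda>v. diffs (\<lambda>v. real ((v + \<sigma> - 1) choose v)) v * t ^ v) \<longlonglongrightarrow> 0"
    by (rule summable_LIMSEQ_zero)
  then have "(\<lambda>v. C * t * (diffs (\<lambda>v. real ((v + \<sigma> - 1) choose v)) v * t ^ v)) \<longlonglongrightarrow> C * t * 0"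
    by (intro tendsto_intros)
  then have R0: "R \<longlonglongrightarrow> 0"
    by (simp add: R_def[abs_def] diffs_def mult_ac)
  have rem: "norm (U 0 x - (\<Sum>i\<le>n. U i c * (x - c) ^ i / fact i)) \<le> R n" for n
  proof -
    have "norm (U 0 x - (\<Sum>i\<le>n. U i c * (x - c) ^ i / fact i))
       \<le> (C * real ((Suc n + \<sigma> - 1) choose Suc n) / \<gamma> ^ Suc n * fact (Suc n))
           * norm (x - c) ^ Suc n / fact n"
    proof (rule field_Taylor[of "{a..b}" n U])
      show "norm (U (Suc n) y) \<le> C * real ((Suc n + \<sigma> - 1) choose Suc n) / \<gamma> ^ Suc n * fact (Suc n)"
        if "y \<in> {a..b}" for y
        using coeff_bound[OF that, of "Suc n"] by (simp add: divide_le_eq del: fact_Suc)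
    qed (use c x deriv in auto)
    also have "\<dots> = R n"
      using \<gamma> by (simp add: R_def t(3) power_mult_distrib field_simps)
    finally show ?thesis .
  qed
  have "(\<lambda>n. U 0 x - (\<Sum>i\<le>n. U i c * (x - c) ^ i / fact i)) \<longlonglongrightarrow> 0"
    by (rule Lim_null_comparison[OF _ R0]) (use rem in auto)
  then have "(\<lambda>n. U 0 x - (U 0 x - (\<Sum>i\<le>n. U i c * (x - c) ^ i / fact i))) \<longlonglongrightarrow> U 0 x - 0"
    by (intro tendsto_intros)
  then have "(\<lambda>n. U n c / fact n * (x - c) ^ n) sums U 0 x"
    by (simp add: sums_def_le)
  then have "(\<lambda>n. complex_of_real (U n c / fact n * (x - c) ^ n)) sums of_real (U 0 x)"
    by (rule sums_of_real)
  then show ?thesis unfolding taylor_def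
    by (simp add: sums_iff)
qed

text \<open>
  The two discs of convergence share the real points near the midpoint of their centres, where both
  series represent \<open>U 0\<close>.
\<close>

lemma taylor_eq_on_overlap:
  assumes c: "c \<in> {a..b}" and c': "c' \<in> {a..b}"
    and z: "z \<in> ball (of_real c) \<gamma>" "z \<in> ball (of_real c') \<gamma>"
  shows "taylor c z = taylor c' z"
proof (cases "c = c'")
  case False
  define S where "S = ball (complex_of_real c) \<gamma> \<inter> ball (of_real c') \<gamma>"
  \<comment> \<open>Lying between the centres puts these points into \<open>{a..b}\<close>. The
    strict inequalities make \<open>I\<close> open, so that its point \<open>m\<close> is a limit
    point.\<close>
  define I where "I = {x. min c c' < x \<and> x < max c c' \<and> \<bar>x - c\<bar> < \<gamma> \<and> \<bar>x - c'\<bar> < \<gamma>}"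
  define m where "m = (c + c') / 2"
  have "dist (complex_of_real c) (of_real c') < 2 * \<gamma>"
    using z dist_triangle[of "complex_of_real c" "of_real c'" z] by (simp add: dist_commute)
  then have "\<bar>c - c'\<bar> < 2 * \<gamma>" by (simp add: dist_norm flip: of_real_diff)
  then have mI: "m \<in> I" using False by (auto simp: I_def m_def abs_if min_def max_def field_simps)
  have "open I"
    unfolding I_def by (intro open_Collect_conj open_Collect_less continuous_intros)
  then have "m islimpt I"
    using mI by (metis interior_open interior_limit_point)
  have lim: "of_real m islimpt (complex_of_real ` I)"
    unfolding islimpt_approachable
  proof (intro allI impI)
    fix e :: real assume "e > 0"
    then obtain y where "y \<in> I" "y \<noteq> m" "dist y m < e"
      using \<open>m islimpt I\<close> unfolding islimpt_approachable by blast
    then show "\<exists>x'\<in>complex_of_real ` I. x' \<noteq> of_real m \<and> dist x' (of_real m) < e"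
      by (intro bexI[of _ "of_real y"]) (auto simp: dist_norm simp flip: of_real_diff)
  qed
  have IS: "of_real x \<in> S" if "x \<in> I" for x
    using that by (auto simp: I_def S_def dist_norm abs_minus_commute simp flip: of_real_diff)
  have "taylor c z - taylor c' z = 0"
  proof (rule analytic_continuation[of "\<lambda>z. taylor c z - taylor c' z" S "of_real ` I" "of_real m"])
    show "(\<lambda>z. taylor c z - taylor c' z) holomorphic_on S"
      by (intro holomorphic_intros holomorphic_on_subset[OF taylor_holomorphic[OF c]]
        holomorphic_on_subset[OF taylor_holomorphic[OF c']]) (auto simp: S_def)
    show "connected S"
      unfolding S_def by (intro convex_connected convex_Int convex_ball)
    show "taylor c w - taylor c' w = 0" if w: "w \<in> of_real ` I" for w
    proof -
      obtain x where x: "x \<in> I" "w = of_real x" using w by blast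
      then have "x \<in> {a..b}" using c c' by (auto simp: I_def)
      then show ?thesis using x c c' by (simp add: I_def taylor_of_real)
    qed
  qed (use z IS mI lim in \<open>auto simp: S_def\<close>)
  then show ?thesis by simp
qed simp

text \<open>The centre is the point of \<open>{a..b}\<close> nearest to \<open>z\<close>. Its disc
  contains \<open>z\<close> as soon as the disc of any other centre does, so a single formula glues
  all the local series.\<close>

definition extension :: "complex \<Rightarrow> complex" where
  "extension z = taylor (max a (min b (Re z))) z"

lemma extension_eq_taylor:
  assumes "c \<in> {a..b}" and "z \<in> ball (of_real c) \<gamma>"
  shows "extension z = taylor c z"
proof -
  define c' where "c' = max a (min b (Re z))"
  have c': "c' \<in> {a..b}" using ab by (auto simp: c'_def)
  have "\<bar>Re z - c'\<bar> \<le> \<bar>Re z - c\<bar>" using assms(1) by (auto simp: c'_def)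
  then have "cmod (z - of_real c') \<le> cmod (z - of_real c)"
    unfolding cmod_def by (intro real_sqrt_le_mono add_mono) (auto simp: abs_le_square_iff)
  then have "z \<in> ball (of_real c') \<gamma>"
    using assms(2) by (simp add: dist_norm norm_minus_commute)
  then show ?thesis
    unfolding extension_def c'_def[symmetric] using taylor_eq_on_overlap[OF c' assms(1)] assms(2) by blast
qed

lemma extension_holomorphic:
  "extension holomorphic_on (\<Union>c\<in>{a..b}. ball (of_real c) \<gamma>)"
proof -
  have "extension holomorphic_on ball (of_real c) \<gamma>" if "c \<in> {a..b}" for c
    using taylor_holomorphic[OF that] extension_eq_taylor[OF that] holomorphic_transform by metis
  then show ?thesis by (intro holomorphic_on_UN_open) auto
qed

lemma extension_of_real: "x \<in> {a..b} \<Longrightarrow> extension (of_real x) = of_real (U 0 x)"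
  using \<gamma> extension_eq_taylor[of x "of_real x"] taylor_of_real[of x x] by simp

text \<open>The series bound carries over from a suitable centre. It degenerates as \<open>t\<close>
  approaches 1, which later forces an ellipse smaller than the largest one.\<close>

lemma extension_norm_le:
  assumes "c \<in> {a..b}" and "cmod (z - of_real c) \<le> t * \<gamma>" and "t < 1"
  shows "cmod (extension z) \<le> C * (1 / (1 - t)) ^ \<sigma>"
proof -
  have "t * \<gamma> < 1 * \<gamma>" using assms(3) \<gamma> by (intro mult_strict_right_mono)
  then have "z \<in> ball (of_real c) \<gamma>" using assms(2) by (simp add: dist_norm norm_minus_commute)
  then show ?thesis using extension_eq_taylor[OF assms(1)] taylor_norm_le[OF assms] by simp
qed

end

section \<open>Approximation on the Bernstein ellipse\<close>

lemma geometric_remainder: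
  fixes w z :: "'a::field"
  assumes "z \<noteq> 0" and "z \<noteq> w"
  shows "1 / (z - w) - (\<Sum>k<n. w ^ k / z ^ Suc k) = (w / z) ^ n / (z - w)"
proof (induction n)
  case (Suc n)
  have "1 / (z - w) - (\<Sum>k<Suc n. w ^ k / z ^ Suc k) = (w / z) ^ n / (z - w) - w ^ n / z ^ Suc n"
    by (simp flip: Suc)
  also have "\<dots> = (w / z) ^ n * (1 / (z - w) - 1 / z)"
    using assms by (simp add: power_divide right_diff_distrib)
  also have "1 / (z - w) - 1 / z = (w / z) / (z - w)"
    using assms by (simp add: field_simps)
  finally show ?case by simp
qed simp

text \<open>On the outer circle Cauchy's kernel is expanded in powers of \<open>w / z\<close>, on
  the inner one in powers of \<open>z / w\<close>, and \<open>geometric_remainder\<close> gives both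
  errors exactly. The inner expansion starts with \<open>1 / w\<close>, so \<open>n - 1\<close> of
  its terms already reach the power \<open>-(n - 1)\<close>, matching the outer ones. Both circles
  obey the same bound, whence the factor 2.\<close>

lemma annulus_approximation:
  fixes G :: "complex \<Rightarrow> complex"
  assumes r: "1 < r" "r < R" and n: "n \<ge> 1"
    and holo: "G holomorphic_on {w. 1 / R < cmod w \<and> cmod w < R}"
    and bound: "\<And>w. cmod w = r \<or> cmod w = 1 / r \<Longrightarrow> cmod (G w) \<le> B"
  obtains p q :: "nat \<Rightarrow> complex" where
    "\<And>w. cmod w = 1 \<Longrightarrow>
      cmod (G w - (\<Sum>k<n. p k * w ^ k) - (\<Sum>k<n-1. q k / w ^ Suc k)) \<le> 2 * B * (r / (r - 1)) / r ^ n"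
proof -
  define S where "S = {w. 1 / R < cmod w \<and> cmod w < R}"
  define c1 where "c1 = circlepath 0 r"
  define c2 where "c2 = circlepath 0 (1 / r)"
  define K where "K = 2 * of_real pi * \<i>"
  have K0: "K \<noteq> 0" by (simp add: K_def)
  have openS: "open S"
    unfolding S_def by (intro open_Collect_conj open_Collect_less continuous_intros)
  have R1: "1 / R < 1 / r" "1 / r < 1" "0 < R" using r by (auto simp: field_simps)
  then have R2: "1 / R < r" "1 / r < R" using r by linarith+
  have im: "path_image c1 = {z. cmod z = r}" "path_image c2 = {z. cmod z = 1 / r}"
    using r by (auto simp: c1_def c2_def path_image_circlepath sphere_def)
  have sub: "path_image c1 \<subseteq> S" "path_image c2 \<subseteq> S"
    using r R1 R2 unfolding im S_def by auto
  have vp: "valid_path c1" "valid_path c2" by (auto simp: c1_def c2_def)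
  have "cmod (G (of_real r)) \<le> B" using bound[of "of_real r"] r by simp
  then have B0: "0 \<le> B" using norm_ge_zero order_trans by blast
  have intg: "f contour_integrable_on c1" "f contour_integrable_on c2"
    if "continuous_on {z. cmod z = r \<or> cmod z = 1 / r} f" for f
  proof -
    have "continuous_on (path_image c1) f" "continuous_on (path_image c2) f"
      using that unfolding im by (auto elim!: continuous_on_subset)
    then show "f contour_integrable_on c1" "f contour_integrable_on c2"
      unfolding c1_def c2_def by (auto intro: contour_integrable_continuous_circlepath)
  qed
  have contG: "continuous_on {z. cmod z = r \<or> cmod z = 1 / r} G"
    by (rule continuous_on_subset[OF holomorphic_on_imp_continuous_on[OF holo]]) (use r R1 R2 in auto)
  have hom: "homotopic_loops S c1 c2"
  proof (rule homotopic_loops_linear)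
    fix t :: real
    have "closed_segment (c1 t) (c2 t) \<subseteq> S"
    proof
      fix z assume "z \<in> closed_segment (c1 t) (c2 t)"
      then obtain u where u: "0 \<le> u" "u \<le> 1" "z = (1 - u) *\<^sub>R c1 t + u *\<^sub>R c2 t"
        by (auto simp: closed_segment_def)
      \<comment> \<open>Both endpoints have the same argument, so up to this phase \<open>s\<close>
        is the point of the segment, and convexity keeps it between \<open>1 / r\<close> and
        \<open>r\<close>.\<close>
      define s where "s = (1 - u) * r + u * (1 / r)"
      have "z = of_real s * exp (2 * of_real pi * \<i> * of_real t)"
        unfolding u c1_def c2_def s_def circlepath by (simp add: scaleR_conv_of_real algebra_simps)
      then have "cmod z = \<bar>s\<bar>" by (simp add: norm_mult)
      moreover have "1 / r \<le> s" "s \<le> r"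
        unfolding s_def using convex_bound_le[of r r "1/r" "1-u" u] convex_bound_le[of "-r" "-(1/r)" "-(1/r)" "1-u" u]
          u r R1 by auto
      moreover have "0 < 1 / r" using r by simp
      ultimately show "z \<in> S" using r R1 by (auto simp: S_def)
    qed
    then show "closed_segment (c1 t) (c2 t) \<subseteq> S" .
  qed (auto simp: c1_def c2_def)
  define p where "p k = contour_integral c1 (\<lambda>z. G z / z ^ Suc k) / K" for k
  define q where "q k = contour_integral c2 (\<lambda>z. G z * z ^ k) / K" for k
  have nz: "z \<noteq> 0" if "cmod z = r \<or> cmod z = 1 / r" for z using that r by auto
  have main: "cmod (G w - (\<Sum>k<n. p k * w ^ k) - (\<Sum>k<n-1. q k / w ^ Suc k)) \<le> 2 * B * (r / (r - 1)) / r ^ n"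
    if w: "cmod w = 1" for w
  proof -
    have neq: "z \<noteq> w" if "cmod z = r \<or> cmod z = 1 / r" for z using that w r R1 by auto
    have w0: "w \<noteq> 0" using w by auto
    \<comment> \<open>The difference quotient has a removable singularity at \<open>w\<close>, so
      its integrals over the two homotopic circles agree. Splitting off the integrals of
      \<open>G w / (z - w)\<close>, which are \<open>K * G w\<close> on the outer and 0 on the inner
      circle, yields Cauchy's formula for the annulus.\<close>
    define Q where "Q = (\<lambda>z. if z = w then deriv G w else (G z - G w) / (z - w))"
    have "Q holomorphic_on S"
      unfolding Q_def by (rule pole_lemma_open) (use holo openS in \<open>auto simp: S_def\<close>)
    then have Qeq: "contour_integral c1 Q = contour_integral c2 Q"
      by (rule Cauchy_theorem_homotopic_loops[OF hom openS _ vp])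
    define I1 where "I1 = contour_integral c1 (\<lambda>z. G z / (z - w))"
    define I2 where "I2 = contour_integral c2 (\<lambda>z. G z / (z - w))"
    have contGw: "continuous_on {z. cmod z = r \<or> cmod z = 1 / r} (\<lambda>z. G z / (z - w))"
      by (intro continuous_intros contG) (use neq in auto)
    have I1: "((\<lambda>z. G z / (z - w)) has_contour_integral I1) c1"
      and I2: "((\<lambda>z. G z / (z - w)) has_contour_integral I2) c2"
      using intg[OF contGw] by (auto simp: I1_def I2_def has_contour_integral_integral)
    have "((\<lambda>z. G w / (z - w)) has_contour_integral K * G w) c1"
      unfolding c1_def K_def by (rule Cauchy_integral_circlepath_simple) (use w r in auto)
    from has_contour_integral_diff[OF I1 this]
    have "(Q has_contour_integral I1 - K * G w) c1"
      by (rule has_contour_integral_eq) (use neq in \<open>auto simp: Q_def im diff_divide_distrib\<close>)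
    moreover have "((\<lambda>z. G w / (z - w)) has_contour_integral 0) c2"
      by (rule Cauchy_theorem_disc_simple[of _ 0 1])
        (use w vp R1 r in \<open>auto intro!: holomorphic_intros simp: im c2_def\<close>)
    from has_contour_integral_diff[OF I2 this]
    have "(Q has_contour_integral I2 - 0) c2"
      by (rule has_contour_integral_eq) (use neq in \<open>auto simp: Q_def im diff_divide_distrib\<close>)
    ultimately have Cauchy: "K * G w = I1 - I2"
      using Qeq by (simp add: contour_integral_unique algebra_simps)
    have E1: "cmod (I1 - (\<Sum>k<n. K * p k * w ^ k)) \<le> B / (r ^ n * (r - 1)) * (2 * pi * r)"
    proof (rule has_contour_integral_bound_circlepath)
      have "((\<lambda>z. G z / z ^ Suc k * w ^ k) has_contour_integral (K * p k * w ^ k)) c1" for k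
      proof -
        have "(\<lambda>z. G z / z ^ Suc k) contour_integrable_on c1"
          by (intro intg continuous_intros contG) (use nz in auto)
        then have "((\<lambda>z. G z / z ^ Suc k) has_contour_integral K * p k) c1"
          using K0 by (simp add: p_def has_contour_integral_integral)
        then show ?thesis by (rule has_contour_integral_rmul)
      qed
      then show "((\<lambda>z. G z / (z - w) - (\<Sum>k<n. G z / z ^ Suc k * w ^ k))
          has_contour_integral I1 - (\<Sum>k<n. K * p k * w ^ k)) (circlepath 0 r)"
        unfolding c1_def[symmetric] by (intro has_contour_integral_diff I1 has_contour_integral_sum) auto
      fix z assume "cmod (z - 0) = r"
      then have z: "cmod z = r" by simp
      then have z0: "z \<noteq> 0" "z \<noteq> w" using nz neq by blast+
      have "G z / (z - w) - (\<Sum>k<n. G z / z ^ Suc k * w ^ k)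
          = G z * (1 / (z - w) - (\<Sum>k<n. w ^ k / z ^ Suc k))"
        by (simp add: right_diff_distrib sum_distrib_left)
      also have "\<dots> = G z * ((w / z) ^ n / (z - w))"
        by (simp only: geometric_remainder[OF z0])
      also have "cmod \<dots> = cmod (G z) * (1 / r ^ n) / cmod (z - w)"
        using w z by (simp add: norm_mult norm_divide norm_power power_one_over)
      also have "\<dots> \<le> B * (1 / r ^ n) / (r - 1)"
        using bound[of z] z w r norm_triangle_ineq2[of z w] B0
        by (intro frac_le mult_right_mono) auto
      finally show "cmod (G z / (z - w) - (\<Sum>k<n. G z / z ^ Suc k * w ^ k)) \<le> B / (r ^ n * (r - 1))"
        by (simp add: field_simps)
    qed (use B0 r in auto)
    \<comment> \<open>\<open>- I2\<close> has the kernel \<open>1 / (w - z)\<close>, so the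
      geometric remainder applies with \<open>w\<close> and \<open>z\<close> exchanged.\<close>
    have E2: "cmod (- I2 - (\<Sum>k<n-1. K * q k / w ^ Suc k))
        \<le> B / (r ^ (n-1) * (1 - 1 / r)) * (2 * pi * (1 / r))"
    proof (rule has_contour_integral_bound_circlepath)
      have "((\<lambda>z. G z * z ^ k / w ^ Suc k) has_contour_integral (K * q k / w ^ Suc k)) c2" for k
      proof -
        have "(\<lambda>z. G z * z ^ k) contour_integrable_on c2"
          by (intro intg continuous_intros contG)
        then have "((\<lambda>z. G z * z ^ k) has_contour_integral K * q k) c2"
          using K0 by (simp add: q_def has_contour_integral_integral)
        then show ?thesis by (rule has_contour_integral_div)
      qed
      then show "((\<lambda>z. - (G z / (z - w)) - (\<Sum>k<n-1. G z * z ^ k / w ^ Suc k))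
          has_contour_integral - I2 - (\<Sum>k<n-1. K * q k / w ^ Suc k)) (circlepath 0 (1 / r))"
        unfolding c2_def[symmetric]
        by (intro has_contour_integral_diff has_contour_integral_neg I2 has_contour_integral_sum) auto
      fix z assume "cmod (z - 0) = 1 / r"
      then have z: "cmod z = 1 / r" by simp
      then have z0: "z \<noteq> 0" "z \<noteq> w" using nz neq by blast+
      have "- (G z / (z - w)) - (\<Sum>k<n-1. G z * z ^ k / w ^ Suc k)
          = G z * (1 / (w - z) - (\<Sum>k<n-1. z ^ k / w ^ Suc k))"
        unfolding right_diff_distrib sum_distrib_left
        by (simp add: minus_divide_right)
      also have "\<dots> = G z * ((z / w) ^ (n-1) / (w - z))"
        using w0 z0 by (subst geometric_remainder) auto
      also have "cmod \<dots> = cmod (G z) * (1 / r ^ (n-1)) / cmod (w - z)"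
        using w z by (simp add: norm_mult norm_divide norm_power power_one_over)
      also have "\<dots> \<le> B * (1 / r ^ (n-1)) / (1 - 1 / r)"
        using bound[of z] z w r R1 norm_triangle_ineq2[of w z] B0
        by (intro frac_le mult_right_mono) auto
      finally show "cmod (- (G z / (z - w)) - (\<Sum>k<n-1. G z * z ^ k / w ^ Suc k))
          \<le> B / (r ^ (n-1) * (1 - 1 / r))"
        by (simp add: field_simps)
    qed (use B0 r R1 in auto)
    have "K * (G w - (\<Sum>k<n. p k * w ^ k) - (\<Sum>k<n-1. q k / w ^ Suc k))
        = (I1 - (\<Sum>k<n. K * p k * w ^ k)) + (- I2 - (\<Sum>k<n-1. K * q k / w ^ Suc k))"
      using Cauchy by (simp add: right_diff_distrib sum_distrib_left mult.assoc)
    then have "cmod K * cmod (G w - (\<Sum>k<n. p k * w ^ k) - (\<Sum>k<n-1. q k / w ^ Suc k))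
        \<le> B / (r ^ n * (r - 1)) * (2 * pi * r) + B / (r ^ (n-1) * (1 - 1 / r)) * (2 * pi * (1 / r))"
      using norm_triangle_mono[OF E1 E2] by (simp flip: norm_mult)
    \<comment> \<open>The inner sum is one term shorter; the circumference \<open>2 * pi / r\<close>
      of the inner circle makes up for the missing power of \<open>r\<close>.\<close>
    also have "B / (r ^ (n-1) * (1 - 1 / r)) * (2 * pi * (1 / r)) = B / (r ^ n * (r - 1)) * (2 * pi * r)"
    proof -
      obtain m where "n = Suc m" using n by (cases n) auto
      then show ?thesis using r by (simp add: field_simps)
    qed
    also have "B / (r ^ n * (r - 1)) * (2 * pi * r) + B / (r ^ n * (r - 1)) * (2 * pi * r)
        = cmod K * (2 * B * (r / (r - 1)) / r ^ n)"
      by (simp add: K_def norm_mult field_simps)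
    finally show ?thesis by (rule mult_left_le_imp_le) (use K0 in simp)
  qed
  show thesis by (rule that) (rule main)
qed

text \<open>The circle of radius \<open>s\<close> about 0 is mapped onto the ellipse with foci -1
  and 1 whose semi-axes are \<open>a\<close> and the absolute value of \<open>b\<close>; for
  \<open>s = 1\<close> it collapses to the segment. Because \<open>a^2 - b^2 = 1\<close>, no point
  of the ellipse is farther from the focal segment than the minor semi-axis.\<close>

lemma joukowski_near_interval:
  fixes w :: complex
  assumes "w \<noteq> 0"
  obtains x where "x \<in> {-1..1::real}"
    "cmod ((w + 1 / w) / 2 - of_real x) \<le> \<bar>cmod w - 1 / cmod w\<bar> / 2"
proof -
  define s where "s = cmod w"
  define a where "a = (s + 1 / s) / 2"
  define b where "b = (s - 1 / s) / 2"
  define u where "u = Re w / s"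
  define v where "v = Im w / s"
  have s: "s > 0" using assms by (simp add: s_def)
  have ab: "a\<^sup>2 = 1 + b\<^sup>2" using s by (simp add: a_def b_def power2_eq_square field_simps)
  have "a > 0" using s by (simp add: a_def add_pos_pos)
  have a1: "a \<ge> 1" using ab \<open>a > 0\<close> by (smt (verit) one_power2 power_mono_iff zero_le_power2 power2_le_imp_le)
  have "s\<^sup>2 = (Re w)\<^sup>2 + (Im w)\<^sup>2" by (simp add: s_def cmod_power2)
  also have "\<dots> = s\<^sup>2 * (u\<^sup>2 + v\<^sup>2)"
    using s by (simp add: u_def v_def power_divide distrib_left)
  finally have uv: "u\<^sup>2 + v\<^sup>2 = 1"
    using s by (simp only: mult_cancel_left1) simp
  then have "u\<^sup>2 \<le> 1" using zero_le_power2[of v] by linarith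
  then have u1: "\<bar>u\<bar> \<le> 1" by (simp add: abs_square_le_1)
  have w: "w = Complex (s * u) (s * v)" using s by (simp add: u_def v_def)
  have inv: "1 / w = Complex (u / s) (- v / s)"
  proof -
    have "w * Complex (u / s) (- v / s) = 1"
      unfolding w using s uv by (simp add: complex_eq_iff power2_eq_square)
    then show ?thesis using assms by (simp add: field_simps)
  qed
  have J: "(w + 1 / w) / 2 = Complex (a * u) (b * v)"
    unfolding inv unfolding w using s by (simp add: complex_eq_iff a_def b_def field_simps)
  \<comment> \<open>\<open>u / a\<close> is where the normal of the ellipse at
    \<open>(a * u, b * v)\<close> meets the real axis.\<close>
  have "cmod ((w + 1 / w) / 2 - of_real (u / a)) \<le> \<bar>b\<bar>"
  proof -
    have "a * u - u / a = u * (a\<^sup>2 - 1) / a"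
      using \<open>a > 0\<close> by (simp add: field_simps power2_eq_square)
    then have 1: "a * u - u / a = u * (b\<^sup>2 / a)"
      using ab by simp
    have "b\<^sup>2 \<le> a\<^sup>2" using ab by linarith
    then have "b\<^sup>2 / a\<^sup>2 \<le> 1" by (rule divide_le_eq_1_pos[THEN iffD2, rotated]) (use \<open>a > 0\<close> in simp)
    then have "b\<^sup>2 * (b\<^sup>2 / a\<^sup>2) \<le> b\<^sup>2 * 1" by (rule mult_left_mono) simp
    then have 2: "(b\<^sup>2 / a)\<^sup>2 \<le> b\<^sup>2" by (simp add: power2_eq_square)
    have "(cmod ((w + 1 / w) / 2 - of_real (u / a)))\<^sup>2 = u\<^sup>2 * (b\<^sup>2 / a)\<^sup>2 + b\<^sup>2 * v\<^sup>2"
      unfolding J cmod_power2 by (simp only: complex.sel minus_complex.sel Re_complex_of_real Im_complex_of_real 1)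
        (simp add: power_mult_distrib power_divide)
    also have "\<dots> \<le> u\<^sup>2 * b\<^sup>2 + b\<^sup>2 * v\<^sup>2"
      by (intro add_right_mono mult_left_mono 2) simp
    also have "\<dots> = b\<^sup>2 * (u\<^sup>2 + v\<^sup>2)" by (simp add: algebra_simps)
    also have "\<dots> = \<bar>b\<bar>\<^sup>2" using uv by simp
    finally show ?thesis by (rule power2_le_imp_le) simp
  qed
  moreover have "u / a \<in> {-1..1}"
    using u1 a1 by (auto simp: field_simps abs_le_iff)
  ultimately show thesis by (intro that[of "u / a"]) (auto simp: b_def s_def)
qed

section \<open>The function \<open>varsigma\<close> and the choice of the radius\<close>

lemma varsigma_ge: "s \<ge> 0 \<Longrightarrow> varsigma s \<ge> 1 + s"
  by (simp add: varsigma_def)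

lemma varsigma_pos: "s > 0 \<Longrightarrow> varsigma s > 0"
  using varsigma_ge[of s] by simp

text \<open>\<open>varsigma s\<close> is \<open>exp (arsinh s)\<close>, with reciprocal
  \<open>sqrt (1 + s^2) - s\<close>. Geometrically, the Joukowski image of the circle of radius
  \<open>varsigma s\<close> has minor semi-axis \<open>s\<close>.\<close>

lemma varsigma_minus_inverse: "s \<ge> 0 \<Longrightarrow> varsigma s - 1 / varsigma s = 2 * s"
proof -
  assume s: "s \<ge> 0"
  have "(sqrt (1 + s\<^sup>2))\<^sup>2 = 1 + s\<^sup>2" by (simp add: add_nonneg_nonneg)
  then have "varsigma s * (sqrt (1 + s\<^sup>2) - s) = 1"
    by (simp add: varsigma_def power2_eq_square algebra_simps)
  moreover have "varsigma s > 0" using varsigma_ge[OF s] s by simp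
  ultimately have "1 / varsigma s = sqrt (1 + s\<^sup>2) - s"
    by (simp add: field_simps)
  then show ?thesis by (simp add: varsigma_def)
qed

lemma varsigma_strict_mono: "0 \<le> s \<Longrightarrow> s < t \<Longrightarrow> varsigma s < varsigma t"
  by (simp add: varsigma_def add_strict_mono power_strict_mono)

text \<open>Shrinking the minor semi-axis by \<open>t\<close> costs the radius no more than the
  factor \<open>t\<close>, so the loss in the \<open>n\<close>-th power of the radius stays within
  \<open>(1 / t) ^ n\<close>.\<close>

lemma varsigma_scale_ge:
  assumes "0 \<le> t" "t \<le> 1"
  shows "t * varsigma s \<le> varsigma (t * s)"
proof -
  have "(t * sqrt (1 + s\<^sup>2))\<^sup>2 \<le> 1 + (t * s)\<^sup>2"
    using assms by (simp add: power_mult_distrib algebra_simps power_le_one)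
  then have "t * sqrt (1 + s\<^sup>2) \<le> sqrt (1 + (t * s)\<^sup>2)"
    by (rule real_le_rsqrt)
  then show ?thesis by (simp add: varsigma_def algebra_simps)
qed

lemma abs_diff_inverse_mono:
  fixes s r :: real
  assumes "1 / r \<le> s" "s \<le> r" "r > 0"
  shows "\<bar>s - 1 / s\<bar> \<le> r - 1 / r"
proof -
  have s: "s > 0" using assms by (meson zero_less_divide_1_iff less_le_trans)
  then have "1 / r \<le> 1 / s" "1 / s \<le> r" using assms by (auto simp: field_simps)
  then show ?thesis using assms by (auto simp: abs_le_iff)
qed

lemma abs_diff_inverse_strict_mono:
  fixes s r :: real
  assumes "1 / r < s" "s < r" "r > 0"
  shows "\<bar>s - 1 / s\<bar> < r - 1 / r"
proof -
  have s: "s > 0" using assms by (meson zero_less_divide_1_iff less_trans)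
  then have "1 / r < 1 / s" "1 / s < r" using assms by (auto simp: field_simps)
  then show ?thesis using assms by (auto simp: abs_less_iff)
qed

text \<open>
  The radius \<open>varsigma (n / (n + 1) * g)\<close> trades the growth of the extension near the boundary of
  its domain against the rate \<open>varsigma g\<close>.
\<close>

lemma radius_tradeoff:
  fixes g :: real
  assumes g: "g > 0" and n: "n \<ge> (1::nat)"
  defines "r \<equiv> varsigma (real n / (real n + 1) * g)"
  shows "r / (r - 1) / r ^ n \<le> exp 1 * (1 + 2 / g) * varsigma g powi (- int n)"
proof -
  define t where "t = real n / (real n + 1)"
  have t: "1 / 2 \<le> t" "t < 1" using n by (auto simp: t_def field_simps)
  have pos: "varsigma g > 0" using g varsigma_pos by blast
  have r1: "r - 1 \<ge> t * g" using varsigma_ge[of "t * g"] t g by (simp add: r_def t_def)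
  have tg: "t * g \<ge> 1 / 2 * g" "t * g > 0" using t g by (auto intro: mult_right_mono)
  have rt: "r \<ge> t * varsigma g" using varsigma_scale_ge[of t g] t by (simp add: r_def t_def)
  have "r / (r - 1) = 1 + 1 / (r - 1)" using r1 tg by (simp add: field_simps)
  \<comment> \<open>\<open>n \<ge> 1\<close> gives \<open>t \<ge> 1 / 2\<close>, hence
    \<open>r - 1 \<ge> g / 2\<close>.\<close>
  also have "1 / (r - 1) \<le> 1 / (1 / 2 * g)"
  proof (rule divide_left_mono)
    show "1 / 2 * g \<le> r - 1" using r1 tg(1) by linarith
    then show "0 < (r - 1) * (1 / 2 * g)" using g by (intro mult_pos_pos) auto
  qed simp
  finally have A: "r / (r - 1) \<le> 1 + 2 / g" by simp
  \<comment> \<open>The factor \<open>exp 1\<close> of the error bound arises here, as a bound for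
    \<open>(1 + 1 / n) ^ n\<close>.\<close>
  have "1 / t = 1 + 1 / real n" using n by (simp add: t_def field_simps)
  also have "\<dots> \<le> exp (1 / real n)" by (rule exp_ge_add_one_self)
  finally have "(1 / t) ^ n \<le> exp (1 / real n) ^ n" using t by (intro power_mono) auto
  also have "\<dots> = exp 1" using n by (simp flip: exp_of_nat_mult)
  finally have e: "(1 / t) ^ n \<le> exp 1" .
  have "1 / r ^ n \<le> 1 / (t * varsigma g) ^ n"
    using rt t pos r1 tg by (intro divide_left_mono power_mono mult_pos_pos zero_less_power) auto
  also have "\<dots> = (1 / t) ^ n * varsigma g powi (- int n)"
    by (simp add: power_mult_distrib power_int_minus divide_inverse power_inverse)
  also have "\<dots> \<le> exp 1 * varsigma g powi (- int n)"
    using e pos by (intro mult_right_mono) auto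
  finally have B: "1 / r ^ n \<le> exp 1 * varsigma g powi (- int n)" .
  have "r / (r - 1) * (1 / r ^ n) \<le> (1 + 2 / g) * (exp 1 * varsigma g powi (- int n))"
  proof (rule mult_mono[OF A B])
    have "0 < r" using r1 tg(2) by linarith
    then show "0 \<le> 1 / r ^ n" by simp
  qed (use g in simp)
  then show ?thesis by (simp add: mult_ac)
qed

section \<open>Chebyshev approximation of a slice\<close>

context factorial_derivative_bounds
begin

text \<open>The Joukowski substitution turns the slice into a function on the annulus that takes the
  same value at \<open>w\<close> and \<open>1 / w\<close>. A Laurent polynomial close to it on the
  unit circle is a trigonometric polynomial in \<open>\<theta> = arccos z\<close>, and its even part
  is a combination of the functions \<open>cos (k * \<theta>)\<close>, that is, of Chebyshev
  polynomials.\<close>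

lemma chebyshev_approximation:
  assumes n: "n \<ge> 1"
  defines "g \<equiv> 2 * \<gamma> / (b - a)"
  obtains c :: "nat \<Rightarrow> real" where
    "\<And>z. z \<in> {-1..1} \<Longrightarrow> \<bar>U 0 (affine_map a b z) - (\<Sum>k<n. c k * cos (real k * arccos z))\<bar>
      \<le> 2 * exp 1 * C * (real n + 1) ^ \<sigma> * (1 + 2 / g) * varsigma g powi (- int n)"
proof -
  define h where "h = (b - a) / 2"
  have h: "h > 0" using ab by (simp add: h_def)
  have g: "g > 0" and hg: "h * g = \<gamma>" using ab \<gamma> by (auto simp: g_def h_def)
  \<comment> \<open>The Joukowski map followed by the affine map to the interval; the minus sign
    follows the reversed orientation of \<open>affine_map\<close>.\<close>
  define J where "J w = of_real ((a + b) / 2) - of_real h * ((w + 1 / w) / 2)" for w :: complex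
  define t where "t = real n / (real n + 1)"
  have t: "0 < t" "t < 1" using n by (auto simp: t_def field_simps)
  define r where "r = varsigma (t * g)"
  \<comment> \<open>The largest admissible radius:
    \<open>h * (R - 1 / R) / 2 = h * g = \<gamma>\<close>, so the open annulus is mapped into the
    \<open>\<gamma>\<close>-neighbourhood of the interval.\<close>
  define R where "R = varsigma g"
  have tg: "0 < t * g" using t g by simp
  then have r1: "1 < r" using varsigma_ge[of "t * g"] unfolding r_def by linarith
  have rR: "r < R" unfolding r_def R_def using t g by (intro varsigma_strict_mono) auto
  have near: "\<exists>x\<in>{a..b}. cmod (J w - of_real x) \<le> h * (\<bar>cmod w - 1 / cmod w\<bar> / 2)" if "w \<noteq> 0" for w
  proof -
    obtain y where y: "y \<in> {-1..1::real}"
      "cmod ((w + 1 / w) / 2 - of_real y) \<le> \<bar>cmod w - 1 / cmod w\<bar> / 2"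
      using joukowski_near_interval[OF \<open>w \<noteq> 0\<close>] .
    define x where "x = (a + b) / 2 - h * y"
    have "\<bar>h * y\<bar> \<le> h" using y h by (simp add: abs_mult abs_le_iff mult_le_cancel_left1)
    then have "x \<in> {a..b}" by (auto simp: x_def h_def abs_le_iff field_simps)
    moreover have "J w - of_real x = - (of_real h * ((w + 1 / w) / 2 - of_real y))"
      by (simp add: J_def x_def right_diff_distrib)
    then have "cmod (J w - of_real x) = h * cmod ((w + 1 / w) / 2 - of_real y)"
      using h by (simp only: norm_minus_cancel norm_mult norm_of_real abs_of_pos)
    ultimately show ?thesis using y h by (intro bexI[of _ x]) auto
  qed
  have holo: "(\<lambda>w. extension (J w)) holomorphic_on {w. 1 / R < cmod w \<and> cmod w < R}"
  proof (rule holomorphic_on_compose_gen[of J _ extension "\<Union>c\<in>{a..b}. ball (of_real c) \<gamma>", unfolded o_def])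
    have Rp: "R > 0" using r1 rR by simp
    have w0: "w \<noteq> 0" if "1 / R < cmod w" for w using that Rp by auto
    then show "J holomorphic_on {w. 1 / R < cmod w \<and> cmod w < R}"
      unfolding J_def by (intro holomorphic_intros) auto
    show "J ` {w. 1 / R < cmod w \<and> cmod w < R} \<subseteq> (\<Union>c\<in>{a..b}. ball (complex_of_real c) \<gamma>)"
    proof
      fix z assume "z \<in> J ` {w. 1 / R < cmod w \<and> cmod w < R}"
      then obtain w where w: "z = J w" "1 / R < cmod w" "cmod w < R" by blast
      obtain x where x: "x \<in> {a..b}" "cmod (J w - of_real x) \<le> h * (\<bar>cmod w - 1 / cmod w\<bar> / 2)"
        using near w0 w by blast
      note x(2)
      also have "h * (\<bar>cmod w - 1 / cmod w\<bar> / 2) < h * ((R - 1 / R) / 2)"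
        using abs_diff_inverse_strict_mono[OF w(2,3) Rp] h by (intro mult_strict_left_mono) auto
      also have "\<dots> = \<gamma>" using varsigma_minus_inverse[of g] g hg by (simp add: R_def)
      finally show "z \<in> (\<Union>c\<in>{a..b}. ball (complex_of_real c) \<gamma>)"
        using x(1) w(1) by (auto simp: dist_norm norm_minus_commute)
    qed
  qed (rule extension_holomorphic)
  have bnd: "cmod (extension (J w)) \<le> C * (real n + 1) ^ \<sigma>" if "cmod w = r \<or> cmod w = 1 / r" for w
  proof -
    have "1 / r < 1" using r1 by simp
    then have "1 / r < r" using r1 by linarith
    then have w: "w \<noteq> 0" "1 / r \<le> cmod w" "cmod w \<le> r"
      using that r1 by auto
    obtain x where x: "x \<in> {a..b}" "cmod (J w - of_real x) \<le> h * (\<bar>cmod w - 1 / cmod w\<bar> / 2)"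
      using near w by blast
    note x(2)
    also have "h * (\<bar>cmod w - 1 / cmod w\<bar> / 2) \<le> h * ((r - 1 / r) / 2)"
      using abs_diff_inverse_mono[OF w(2,3)] h r1 by (intro mult_left_mono) auto
    also have "\<dots> = t * \<gamma>" using varsigma_minus_inverse[of "t * g"] t g hg by (simp add: r_def)
    finally have "cmod (extension (J w)) \<le> C * (1 / (1 - t)) ^ \<sigma>"
      by (rule extension_norm_le[OF x(1) _ t(2)])
    moreover have "1 / (1 - t) = real n + 1" by (simp add: t_def field_simps)
    ultimately show ?thesis by simp
  qed
  define B where "B = C * (real n + 1) ^ \<sigma>"
  define err where "err = 2 * B * (r / (r - 1)) / r ^ n"
  obtain p q :: "nat \<Rightarrow> complex" where
    pq: "\<And>w. cmod w = 1 \<Longrightarrow>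
      cmod (extension (J w) - (\<Sum>k<n. p k * w ^ k) - (\<Sum>k<n-1. q k / w ^ Suc k)) \<le> err"
    using annulus_approximation[OF r1 rR n holo bnd] unfolding err_def B_def by blast
  have err: "err \<le> 2 * exp 1 * C * (real n + 1) ^ \<sigma> * (1 + 2 / g) * varsigma g powi (- int n)"
  proof -
    have "err = 2 * B * (r / (r - 1) / r ^ n)" by (simp add: err_def)
    also have "\<dots> \<le> 2 * B * (exp 1 * (1 + 2 / g) * varsigma g powi (- int n))"
      using radius_tradeoff[OF g n] C unfolding r_def t_def B_def
      by (intro mult_left_mono) auto
    finally show ?thesis by (simp add: B_def mult_ac)
  qed
  \<comment> \<open>The shift lets both sums run over \<open>k < n\<close> with exponent
    \<open>k\<close>; the value 0 at the index 0 pads the shorter one.\<close>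
  define q' where "q' k = (case k of 0 \<Rightarrow> 0 | Suc j \<Rightarrow> q j)" for k
  have q': "(\<Sum>k<n-1. q k / w ^ Suc k) = (\<Sum>k<n. q' k / w ^ k)" for w
  proof -
    obtain m where m: "n = Suc m" using n by (cases n) auto
    show ?thesis unfolding m by (simp add: sum.lessThan_Suc_shift q'_def del: sum.lessThan_Suc)
  qed
  \<comment> \<open>\<open>U 0\<close> is real, so taking real parts does not increase the
    error.\<close>
  define c where "c k = Re (p k + q' k)" for k
  show thesis
  proof (rule that[of c])
    fix z :: real assume z: "z \<in> {-1..1}"
    define \<theta> where "\<theta> = arccos z"
    have cz: "cos \<theta> = z" using z by (simp add: \<theta>_def)
    have joukowski_cis: "(cis \<phi> + 1 / cis \<phi>) / 2 = of_real (cos \<phi>)" for \<phi>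
      unfolding inverse_eq_divide[symmetric] cis_inverse by (simp add: complex_eq_iff)
    have J': "J (cis \<phi>) = of_real ((a + b) / 2 - h * cos \<phi>)" for \<phi>
      unfolding J_def joukowski_cis by (simp only: of_real_diff of_real_mult)
    have "(a - b) / 2 = - h" by (simp add: h_def minus_divide_left)
    then have aff: "affine_map a b z = (a + b) / 2 - h * z"
      unfolding affine_map_def by simp
    have J: "J (cis \<theta>) = of_real (affine_map a b z)" "J (cis (- \<theta>)) = of_real (affine_map a b z)"
      unfolding J' aff using cz by simp_all
    have "affine_map a b z \<in> {a..b}"
    proof -
      have "\<bar>h * z\<bar> \<le> h" using z h by (simp add: abs_mult abs_le_iff mult_le_cancel_left1)
      then show ?thesis unfolding aff by (auto simp: h_def abs_le_iff field_simps)
    qed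
    then have ext: "extension (of_real (affine_map a b z)) = of_real (U 0 (affine_map a b z))"
      by (rule extension_of_real)
    define u where "u = complex_of_real (U 0 (affine_map a b z))"
    define P where "P w = (\<Sum>k<n. p k * w ^ k) + (\<Sum>k<n. q' k / w ^ k)" for w
    have 1: "cmod (u - P (cis \<theta>)) \<le> err" "cmod (u - P (cis (- \<theta>))) \<le> err"
      using pq[OF norm_cis, of \<theta>] pq[OF norm_cis, of "- \<theta>"]
      unfolding q' J ext u_def P_def diff_diff_eq by blast+
    \<comment> \<open>\<open>J\<close> takes the same value at \<open>cis \<theta>\<close> and
      \<open>cis (- \<theta>)\<close>, so both values of \<open>P\<close> approximate
      \<open>u\<close>. Their average has no sine parts and keeps the error bound.\<close>
    have "P (cis \<theta>) + P (cis (- \<theta>)) = (\<Sum>k<n. 2 * (p k + q' k) * of_real (cos (real k * \<theta>)))"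
    proof -
      have "p k * cis \<theta> ^ k + q' k / cis \<theta> ^ k + (p k * cis (- \<theta>) ^ k + q' k / cis (- \<theta>) ^ k)
          = 2 * (p k + q' k) * of_real (cos (real k * \<theta>))" for k
      proof -
        have "cis (real k * \<theta>) + cis (- (real k * \<theta>)) = 2 * of_real (cos (real k * \<theta>))"
          by (simp add: complex_eq_iff)
        moreover have "p k * cis \<theta> ^ k + q' k / cis \<theta> ^ k + (p k * cis (- \<theta>) ^ k + q' k / cis (- \<theta>) ^ k)
          = (p k + q' k) * (cis (real k * \<theta>) + cis (- (real k * \<theta>)))"
          by (simp only: Complex.DeMoivre divide_inverse cis_inverse mult_minus_right minus_minus
              distrib_left distrib_right add_ac)
        ultimately show ?thesis by simp
      qed
      then show ?thesis unfolding P_def by (simp add: sum.distrib[symmetric])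
    qed
    then have "2 * (u - (\<Sum>k<n. (p k + q' k) * of_real (cos (real k * \<theta>))))
        = (u - P (cis \<theta>)) + (u - P (cis (- \<theta>)))"
      by (simp add: sum_distrib_left algebra_simps)
    then have "2 * cmod (u - (\<Sum>k<n. (p k + q' k) * of_real (cos (real k * \<theta>)))) \<le> err + err"
      using norm_triangle_mono[OF 1] by (metis (no_types) norm_mult norm_numeral)
    then have "cmod (u - (\<Sum>k<n. (p k + q' k) * of_real (cos (real k * \<theta>)))) \<le> err"
      by simp
    then have "\<bar>Re (u - (\<Sum>k<n. (p k + q' k) * of_real (cos (real k * \<theta>))))\<bar> \<le> err"
      by (rule order_trans[OF abs_Re_le_cmod])
    then show "\<bar>U 0 (affine_map a b z) - (\<Sum>k<n. c k * cos (real k * arccos z))\<bar>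
      \<le> 2 * exp 1 * C * (real n + 1) ^ \<sigma> * (1 + 2 / g) * varsigma g powi (- int n)"
      using err by (simp add: u_def c_def \<theta>_def Re_sum)
  qed
qed

end

section \<open>Chebyshev interpolation\<close>

lemma cheb_T_0 [simp]: "cheb_T 0 x = 1"
  by (simp add: cheb_T_def)

lemma cheb_T_1 [simp]: "x \<in> {-1..1} \<Longrightarrow> cheb_T (Suc 0) x = x"
  by (simp add: cheb_T_def)

lemma cheb_T_rec:
  assumes "x \<in> {-1..1}"
  shows "cheb_T (Suc (Suc k)) x = 2 * x * cheb_T (Suc k) x - cheb_T k x"
proof -
  define t where "t = arccos x"
  have "cos t = x" using assms by (simp add: t_def)
  moreover have "real (Suc (Suc k)) * t = real (Suc k) * t + t" "real k * t = real (Suc k) * t - t"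
    by (simp_all add: algebra_simps)
  ultimately show ?thesis
    unfolding cheb_T_def t_def[symmetric] by (simp add: cos_add cos_diff)
qed

text \<open>The three-term recurrence raises the degree by one. Agreement is restricted to
  \<open>{-1..1}\<close>, where \<open>arccos\<close> inverts \<open>cos\<close>.\<close>

lemma cheb_T_poly:
  obtains p where "degree p \<le> k" "\<And>x. x \<in> {-1..1} \<Longrightarrow> cheb_T k x = poly p x"
proof -
  have "\<exists>p. degree p \<le> k \<and> (\<forall>x\<in>{-1..1}. cheb_T k x = poly p x)"
  proof (induction k rule: induct_nat_012)
    case 0
    show ?case by (intro exI[of _ 1]) simp
  next
    case 1
    show ?case by (intro exI[of _ "[:0, 1:]"]) simp
  next
    case (ge2 k)
    then obtain p q where p: "degree p \<le> k" "\<forall>x\<in>{-1..1}. cheb_T k x = poly p x"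
      and q: "degree q \<le> Suc k" "\<forall>x\<in>{-1..1}. cheb_T (Suc k) x = poly q x" by blast
    have "degree ([:0, 2:] * q - p) \<le> Suc (Suc k)"
      using p(1) q(1) degree_mult_le[of "[:0, 2:]" q] by (intro degree_diff_le) auto
    then show ?case
      using p(2) q(2) by (intro exI[of _ "[:0, 2:] * q - p"]) (simp add: cheb_T_rec)
  qed
  then show thesis using that by blast
qed

text \<open>The recurrence makes the right-hand sides telescope. At two zeros of
  \<open>cheb_T n\<close> the right-hand side for \<open>n - 1\<close> vanishes, which gives the
  off-diagonal values of the kernel at the nodes.\<close>

lemma cheb_T_christoffel_darboux:
  assumes "x \<in> {-1..1}" "y \<in> {-1..1}"
  shows "(x - y) * (1 + 2 * (\<Sum>k=1..n. cheb_T k x * cheb_T k y))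
    = cheb_T (Suc n) x * cheb_T n y - cheb_T n x * cheb_T (Suc n) y"
proof (induction n)
  case 0
  show ?case using assms by simp
next
  case (Suc n)
  have "(x - y) * (1 + 2 * (\<Sum>k=1..Suc n. cheb_T k x * cheb_T k y))
      = (x - y) * (1 + 2 * (\<Sum>k=1..n. cheb_T k x * cheb_T k y))
        + 2 * (x - y) * cheb_T (Suc n) x * cheb_T (Suc n) y"
    by (simp add: algebra_simps)
  also have "\<dots> = cheb_T (Suc (Suc n)) x * cheb_T (Suc n) y - cheb_T (Suc n) x * cheb_T (Suc (Suc n)) y"
    unfolding Suc cheb_T_rec[OF assms(1)] cheb_T_rec[OF assms(2)] by (simp add: algebra_simps)
  finally show ?case .
qed

text \<open>This is \<open>cheb_basis\<close> pulled back to the reference interval. Up to the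
  factor \<open>2 / n\<close> it is the Christoffel-Darboux kernel of the Chebyshev polynomials, in
  which the constant term has weight \<open>1 / 2\<close>.\<close>

definition cheb_kernel :: "nat \<Rightarrow> real \<Rightarrow> real \<Rightarrow> real" where
  "cheb_kernel n w z = 1 / real n + 2 / real n * (\<Sum>k=1..n - 1. cheb_T k w * cheb_T k z)"

lemma finite_cheb_nodes: "finite (cheb_nodes n)"
  using cheb_nodes_bij bij_betw_finite by blast

lemma card_cheb_nodes: "card (cheb_nodes n) = n"
  by (simp flip: bij_betw_same_card[OF cheb_nodes_bij])

text \<open>
  On the diagonal, \<open>2 T\<^sub>k(w)\<^sup>2 = 1 + cos 2kt\<close> with \<open>w = cos t\<close>, and as \<open>cos nt = 0\<close> the terms
  \<open>cos 2kt\<close> and \<open>cos 2(n - k)t\<close> cancel.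
\<close>

lemma cheb_kernel_cheb_nodes:
  assumes n: "n \<ge> 1" and w: "w \<in> cheb_nodes n" and z: "z \<in> cheb_nodes n"
  shows "cheb_kernel n w z = (if w = z then 1 else 0)"
proof (cases "w = z")
  case False
  obtain m where m: "n = Suc m" using n by (cases n) auto
  have "(w - z) * (1 + 2 * (\<Sum>k=1..m. cheb_T k w * cheb_T k z)) = 0"
    using w z cheb_T_christoffel_darboux[of w z m] by (auto simp: m cheb_nodes_def)
  then have "1 + 2 * (\<Sum>k=1..n - 1. cheb_T k w * cheb_T k z) = 0"
    using False by (simp add: m)
  moreover have "cheb_kernel n w z = (1 + 2 * (\<Sum>k=1..n - 1. cheb_T k w * cheb_T k z)) / n"
    by (simp add: cheb_kernel_def add_divide_distrib)
  ultimately show ?thesis using False by simp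
next
  case True
  define t where "t = arccos w"
  have c0: "cos (real n * t) = 0" using w by (simp add: cheb_nodes_def cheb_T_def t_def)
  have c: "cos (2 * (real n * t)) = - 1" "sin (2 * (real n * t)) = 0"
    unfolding cos_double_cos sin_double using c0 by auto
  define S where "S = (\<Sum>k=1..n - 1. cos (2 * (real k * t)))"
  have "S = (\<Sum>k=1..n - 1. cos (2 * (real (n - k) * t)))"
    unfolding S_def by (rule sum.reindex_bij_witness[of _ "\<lambda>k. n - k" "\<lambda>k. n - k"]) auto
  also have "\<dots> = (\<Sum>k=1..n - 1. - cos (2 * (real k * t)))"
  proof (rule sum.cong)
    fix k assume k: "k \<in> {1..n - 1}"
    then have "k \<le> n" unfolding atLeastAtMost_iff by linarith
    then have "real (n - k) = real n - real k" by (rule of_nat_diff)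
    then have "2 * (real (n - k) * t) = 2 * (real n * t) - 2 * (real k * t)"
      by (simp add: left_diff_distrib)
    then show "cos (2 * (real (n - k) * t)) = - cos (2 * (real k * t))"
      by (simp add: cos_diff c)
  qed simp
  also have "\<dots> = - S" by (simp add: S_def sum_negf)
  finally have S: "S = 0" by simp
  have "2 * (\<Sum>k=1..n - 1. cheb_T k w * cheb_T k w) = (\<Sum>k=1..n - 1. 1 + cos (2 * (real k * t)))"
    by (simp add: cheb_T_def t_def cos_double_cos sum_distrib_left power2_eq_square)
  also have "\<dots> = real (n - 1) + S" by (simp add: sum.distrib S_def)
  finally have "2 * (\<Sum>k=1..n - 1. cheb_T k w * cheb_T k w) = real n - 1"
    using n S by (simp add: of_nat_diff)
  moreover have "cheb_kernel n w w = (1 + 2 * (\<Sum>k=1..n - 1. cheb_T k w * cheb_T k w)) / n"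
    by (simp add: cheb_kernel_def add_divide_distrib)
  ultimately show ?thesis using n True by simp
qed

section \<open>Lagrange basis and Lebesgue constant\<close>

lemma lagrange_basis_poly:
  assumes "finite Z" "z \<in> Z"
  obtains p where "degree p \<le> card Z - 1" "\<And>x. lagrange_basis Z z x = poly p x"
proof (rule that[of "\<Prod>w\<in>Z - {z}. [:- w / (z - w), 1 / (z - w):]"])
  have "degree (\<Prod>w\<in>Z - {z}. [:- w / (z - w), 1 / (z - w):])
      \<le> sum (degree \<circ> (\<lambda>w. [:- w / (z - w), 1 / (z - w):])) (Z - {z})"
    by (rule degree_prod_sum_le) (use assms in simp)
  also have "\<dots> \<le> (\<Sum>w\<in>Z - {z}. 1)" by (intro sum_mono) simp
  also have "\<dots> = card Z - 1" using assms by simp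
  finally show "degree (\<Prod>w\<in>Z - {z}. [:- w / (z - w), 1 / (z - w):]) \<le> card Z - 1" .
qed (simp add: lagrange_basis_def poly_prod diff_divide_distrib)

lemma lagrange_basis_at_node:
  assumes "finite Z" "z \<in> Z" "y \<in> Z"
  shows "lagrange_basis Z z y = (if y = z then 1 else 0)"
proof (cases "y = z")
  case True
  then show ?thesis by (simp add: lagrange_basis_def)
next
  case False
  then have "\<exists>w\<in>Z - {z}. (y - w) / (z - w) = 0" using assms by (intro bexI[of _ y]) auto
  then show ?thesis using False assms(1) by (simp only: lagrange_basis_def prod_zero_iff finite_Diff if_False)
qed

lemma lagrange_interpolation:
  assumes "finite Z" "degree p < card Z"
  shows "poly p x = (\<Sum>z\<in>Z. poly p z * lagrange_basis Z z x)"
proof -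
  have "\<forall>z\<in>Z. \<exists>q. degree q \<le> card Z - 1 \<and> (\<forall>x. lagrange_basis Z z x = poly q x)"
    using lagrange_basis_poly[OF assms(1)] by metis
  then obtain q where q: "\<And>z. z \<in> Z \<Longrightarrow> degree (q z) \<le> card Z - 1"
    "\<And>z x. z \<in> Z \<Longrightarrow> lagrange_basis Z z x = poly (q z) x" by metis
  define P where "P = (\<Sum>z\<in>Z. Polynomial.smult (poly p z) (q z))"
  have P: "poly P x = (\<Sum>z\<in>Z. poly p z * lagrange_basis Z z x)" for x
    by (simp add: P_def poly_sum q(2))
  have "p = P"
  proof (rule poly_eqI_degree[of Z])
    fix x assume x: "x \<in> Z"
    have "poly P x = (\<Sum>z\<in>Z. if z = x then poly p z else 0)"
      unfolding P by (intro sum.cong) (auto simp: lagrange_basis_at_node assms(1) x)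
    then show "poly p x = poly P x" using x assms(1) by simp
  next
    have "degree P \<le> card Z - 1"
      unfolding P_def using q(1) assms(1) degree_smult_le order_trans by (intro degree_sum_le) blast+
    then show "degree P < card Z" using assms(2) by simp
  qed (use assms in simp)
  then have "poly p x = poly P x" by (rule arg_cong)
  then show ?thesis unfolding P .
qed

text \<open>On \<open>{-1..1}\<close> both sides are polynomials of degree at most
  \<open>n - 1\<close> in \<open>z\<close>, and both are the Kronecker delta at the \<open>n\<close>
  nodes. This ties the explicit sums of the PTTK basis to the Lebesgue constant.\<close>

lemma lagrange_basis_cheb_nodes:
  assumes n: "n \<ge> 1" and w: "w \<in> cheb_nodes n" and z: "z \<in> {-1..1}"
  shows "lagrange_basis (cheb_nodes n) w z = cheb_kernel n w z"
proof -
  have "\<forall>k. \<exists>p. degree p \<le> k \<and> (\<forall>x\<in>{-1..1}. cheb_T k x = poly p x)"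
    using cheb_T_poly by metis
  then obtain P where P: "\<And>k. degree (P k) \<le> k"
    "\<And>k x. x \<in> {-1..1} \<Longrightarrow> cheb_T k x = poly (P k) x" by metis
  define p where "p = [:1 / real n:] + Polynomial.smult (2 / real n) (\<Sum>k=1..n - 1. Polynomial.smult (cheb_T k w) (P k))"
  have deg: "degree p \<le> n - 1"
    unfolding p_def
    by (intro degree_add_le order_trans[OF degree_smult_le] degree_sum_le order_trans[OF P(1)]) auto
  have p: "poly p x = cheb_kernel n w x" if "x \<in> {-1..1}" for x
    using that by (simp add: p_def cheb_kernel_def poly_sum P(2))
  have sub: "cheb_nodes n \<subseteq> {-1..1}" by (auto simp: cheb_nodes_def)
  have "cheb_kernel n w z = (\<Sum>y\<in>cheb_nodes n. poly p y * lagrange_basis (cheb_nodes n) y z)"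
    unfolding p[OF z, symmetric]
    by (rule lagrange_interpolation) (use deg n in \<open>auto simp: finite_cheb_nodes card_cheb_nodes\<close>)
  also have "\<dots> = (\<Sum>y\<in>cheb_nodes n. if y = w then lagrange_basis (cheb_nodes n) y z else 0)"
    using p sub n w by (intro sum.cong) (auto simp: cheb_kernel_cheb_nodes subset_iff)
  also have "\<dots> = lagrange_basis (cheb_nodes n) w z" using w finite_cheb_nodes by simp
  finally show ?thesis ..
qed

lemma sum_lagrange_basis_le:
  assumes n: "n \<ge> 1" and z: "z \<in> {-1..1}"
  shows "(\<Sum>w\<in>cheb_nodes n. \<bar>lagrange_basis (cheb_nodes n) w z\<bar>) \<le> lebesgue_const (n - 1)"
proof -
  have "continuous_on {-1..1} (\<lambda>x. \<Sum>w\<in>cheb_nodes n. \<bar>lagrange_basis (cheb_nodes n) w x\<bar>)"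
    unfolding lagrange_basis_def divide_inverse by (intro continuous_intros)
  then have "bdd_above ((\<lambda>x. \<Sum>w\<in>cheb_nodes n. \<bar>lagrange_basis (cheb_nodes n) w x\<bar>) ` {-1..1})"
    by (intro bounded_imp_bdd_above compact_imp_bounded compact_continuous_image) auto
  then have "(\<Sum>w\<in>cheb_nodes n. \<bar>lagrange_basis (cheb_nodes n) w z\<bar>)
      \<le> (SUP x\<in>{-1..1}. \<Sum>w\<in>cheb_nodes n. \<bar>lagrange_basis (cheb_nodes n) w x\<bar>)"
    by (rule cSUP_upper[OF z])
  then show ?thesis using n by (simp add: lebesgue_const_def)
qed

lemma lebesgue_const_nonneg:
  assumes "n \<ge> 1"
  shows "lebesgue_const (n - 1) \<ge> 0"
proof -
  have "0 \<le> (\<Sum>w\<in>cheb_nodes n. \<bar>lagrange_basis (cheb_nodes n) w 0\<bar>)"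
    by (intro sum_nonneg) simp
  also have "\<dots> \<le> lebesgue_const (n - 1)" using assms by (intro sum_lagrange_basis_le) auto
  finally show ?thesis .
qed

section \<open>Interpolation on a general interval\<close>

lemma inv_affine_map:
  assumes "a < b" "x \<in> {a..b}"
  shows "inv_into {-1..1} (affine_map a b) x = (2 * x - (a + b)) / (a - b)"
    and "(2 * x - (a + b)) / (a - b) \<in> {-1..1}"
    and "affine_map a b ((2 * x - (a + b)) / (a - b)) = x"
proof -
  show r: "(2 * x - (a + b)) / (a - b) \<in> {-1..1}"
    using assms by (auto simp: divide_simps)
  show e: "affine_map a b ((2 * x - (a + b)) / (a - b)) = x"
    using assms by (simp add: affine_map_def divide_simps) (simp add: algebra_simps)
  have "inj_on (affine_map a b) {-1..1}"
    using assms by (auto simp: inj_on_def affine_map_def)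
  then show "inv_into {-1..1} (affine_map a b) x = (2 * x - (a + b)) / (a - b)"
    using r e by (metis inv_into_f_f)
qed

lemma affine_map_in_interval:
  assumes "a < b" "z \<in> {-1..1}"
  shows "affine_map a b z \<in> {a..b}"
proof -
  define h where "h = (b - a) / 2"
  have h: "h > 0" using assms by (simp add: h_def)
  have "\<bar>h * z\<bar> \<le> h" using assms h by (simp add: abs_mult abs_le_iff mult_le_cancel_left1)
  moreover have "affine_map a b z = (a + b) / 2 - h * z"
    by (simp add: affine_map_def h_def left_diff_distrib diff_divide_distrib)
  ultimately show ?thesis by (auto simp: h_def abs_le_iff field_simps)
qed

lemma cheb_basis_eq_cheb_kernel:
  assumes "a < b" "x \<in> {a..b}"
  shows "cheb_basis n \<zeta> a b i x = cheb_kernel n (\<zeta> i) ((2 * x - (a + b)) / (a - b))"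
  unfolding cheb_basis_def cheb_kernel_def inv_affine_map(1)[OF assms] ..

lemma cheb_basis_continuous:
  assumes "a < b"
  shows "continuous_on {a..b} (cheb_basis n \<zeta> a b i)"
proof -
  have "continuous_on {a..b} (\<lambda>x. cheb_kernel n (\<zeta> i) ((2 * x - (a + b)) / (a - b)))"
    unfolding cheb_kernel_def cheb_T_def using assms inv_affine_map(2)[OF assms]
    by (intro continuous_intros) auto
  then show ?thesis
    by (rule continuous_on_eq) (use assms in \<open>simp add: cheb_basis_eq_cheb_kernel\<close>)
qed

text \<open>\<open>h\<close> is left general for two uses: absolute values, which give the Lebesgue
  constant, and nodal values times the basis, which give the interpolant. Reindexing along the
  bijection makes the order of the nodes immaterial.\<close>

lemma sum_cheb_basis:
  assumes n: "n \<ge> 1" and ab: "a < b" and x: "x \<in> {a..b}"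
    and nodes: "bij_betw \<zeta> {1..n} (cheb_nodes n)"
  shows "(\<Sum>i=1..n. h (\<zeta> i) (cheb_basis n \<zeta> a b i x))
    = (\<Sum>w\<in>cheb_nodes n. h w (lagrange_basis (cheb_nodes n) w ((2 * x - (a + b)) / (a - b))))"
proof -
  have "(\<Sum>i=1..n. h (\<zeta> i) (cheb_basis n \<zeta> a b i x))
      = (\<Sum>i=1..n. h (\<zeta> i) (lagrange_basis (cheb_nodes n) (\<zeta> i) ((2 * x - (a + b)) / (a - b))))"
    using inv_affine_map(2)[OF ab x] bij_betwE[OF nodes] n
    by (intro sum.cong) (auto simp: cheb_basis_eq_cheb_kernel[OF ab x] lagrange_basis_cheb_nodes)
  then show ?thesis using sum.reindex_bij_betw[OF nodes] by simp
qed

lemma sum_abs_cheb_basis_le: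
  assumes "n \<ge> 1" "a < b" "x \<in> {a..b}" "bij_betw \<zeta> {1..n} (cheb_nodes n)"
  shows "(\<Sum>i=1..n. \<bar>cheb_basis n \<zeta> a b i x\<bar>) \<le> lebesgue_const (n - 1)"
  unfolding sum_cheb_basis[OF assms, of "\<lambda>_ y. \<bar>y\<bar>"]
  by (rule sum_lagrange_basis_le[OF assms(1) inv_affine_map(2)[OF assms(2,3)]])

text \<open>Interpolation reproduces the approximating polynomial \<open>p\<close>, so the error is
  that of interpolating \<open>u - p\<close>. The difference itself contributes
  \<open>\<epsilon>\<close>, its interpolant at most the Lebesgue constant times
  \<open>\<epsilon>\<close>.\<close>

lemma cheb_interpolation_error:
  fixes u :: "real \<Rightarrow> real"
  assumes n: "n \<ge> 1" and ab: "a < b" and x: "x \<in> {a..b}"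
    and nodes: "bij_betw \<zeta> {1..n} (cheb_nodes n)"
    and approx: "\<And>z. z \<in> {-1..1} \<Longrightarrow> \<bar>u (affine_map a b z) - (\<Sum>k<n. c k * cheb_T k z)\<bar> \<le> \<epsilon>"
  shows "\<bar>u x - (\<Sum>i=1..n. cheb_basis n \<zeta> a b i x * u (affine_map a b (\<zeta> i)))\<bar>
    \<le> (lebesgue_const (n - 1) + 1) * \<epsilon>"
proof -
  define z where "z = (2 * x - (a + b)) / (a - b)"
  define \<phi> where "\<phi> i = cheb_basis n \<zeta> a b i x" for i
  define p where "p z = (\<Sum>k<n. c k * cheb_T k z)" for z
  have z: "z \<in> {-1..1}" "affine_map a b z = x"
    using inv_affine_map[OF ab x] by (auto simp: z_def)
  have \<zeta>: "\<zeta> i \<in> {-1..1}" if "i \<in> {1..n}" for i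
    using bij_betwE[OF nodes] that by (auto simp: cheb_nodes_def)
  have "\<forall>k. \<exists>p. degree p \<le> k \<and> (\<forall>x\<in>{-1..1}. cheb_T k x = poly p x)"
    using cheb_T_poly by metis
  then obtain P where P: "\<And>k. degree (P k) \<le> k"
    "\<And>k x. x \<in> {-1..1} \<Longrightarrow> cheb_T k x = poly (P k) x" by metis
  define Q where "Q = (\<Sum>k<n. Polynomial.smult (c k) (P k))"
  have Q: "poly Q y = p y" if "y \<in> {-1..1}" for y
    using that by (simp add: Q_def p_def poly_sum P(2))
  have "degree Q \<le> n - 1"
    unfolding Q_def
    by (intro degree_sum_le order_trans[OF degree_smult_le] order_trans[OF P(1)]) auto
  then have "p z = (\<Sum>w\<in>cheb_nodes n. poly Q w * lagrange_basis (cheb_nodes n) w z)"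
    unfolding Q[OF z(1), symmetric]
    by (intro lagrange_interpolation) (use n in \<open>auto simp: finite_cheb_nodes card_cheb_nodes\<close>)
  also have "\<dots> = (\<Sum>i=1..n. poly Q (\<zeta> i) * \<phi> i)"
    using sum_cheb_basis[OF n ab x nodes, of "\<lambda>w y. poly Q w * y"] by (simp add: \<phi>_def z_def)
  also have "\<dots> = (\<Sum>i=1..n. p (\<zeta> i) * \<phi> i)"
    using Q \<zeta> by (intro sum.cong) auto
  finally have pz: "p z = (\<Sum>i=1..n. p (\<zeta> i) * \<phi> i)" .
  have "u x - (\<Sum>i=1..n. \<phi> i * u (affine_map a b (\<zeta> i)))
      = (u x - p z) - (\<Sum>i=1..n. \<phi> i * (u (affine_map a b (\<zeta> i)) - p (\<zeta> i)))"
    unfolding pz by (simp add: right_diff_distrib sum_subtractf mult.commute)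
  also have "\<bar>\<dots>\<bar> \<le> \<bar>u x - p z\<bar> + (\<Sum>i=1..n. \<bar>\<phi> i * (u (affine_map a b (\<zeta> i)) - p (\<zeta> i))\<bar>)"
    by (intro order_trans[OF abs_triangle_ineq4] add_left_mono sum_abs)
  also have "\<dots> \<le> \<epsilon> + (\<Sum>i=1..n. \<bar>\<phi> i\<bar> * \<epsilon>)"
    using approx[OF z(1)] approx[OF \<zeta>] unfolding z(2) p_def
    by (intro add_mono sum_mono) (auto simp: abs_mult intro!: mult_left_mono)
  also have "(\<Sum>i=1..n. \<bar>\<phi> i\<bar> * \<epsilon>) \<le> lebesgue_const (n - 1) * \<epsilon>"
    using sum_abs_cheb_basis_le[OF n ab x nodes] approx[OF z(1)]
    unfolding \<phi>_def sum_distrib_right[symmetric] by (intro mult_right_mono) auto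
  finally show ?thesis by (simp add: \<phi>_def distrib_right)
qed

section \<open>Tensor products and matrix chains\<close>

lemma sum_PiE_insert:
  assumes "x \<notin> S"
  shows "(\<Sum>g\<in>Pi\<^sub>E (insert x S) B. h g) = (\<Sum>y\<in>B x. \<Sum>g\<in>Pi\<^sub>E S B. h (g(x := y)))"
proof -
  have "(\<Sum>g\<in>Pi\<^sub>E (insert x S) B. h g) = (\<Sum>(y, g)\<in>B x \<times> Pi\<^sub>E S B. h (g(x := y)))"
    unfolding PiE_insert_eq
    by (subst sum.reindex[OF inj_combinator[OF assms]]) (simp add: case_prod_unfold)
  then show ?thesis by (simp add: sum.cartesian_product)
qed

text \<open>
  The coordinates are interpolated one after the other; the error of the \<open>(m + 1)\<close>-st step is
  amplified by the \<open>m\<close> interpolation operators already applied.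
\<close>

lemma tensor_interpolation_error:
  fixes f :: "(nat \<Rightarrow> real) \<Rightarrow> real" and \<phi> :: "nat \<Rightarrow> nat \<Rightarrow> real \<Rightarrow> real" and \<eta> :: "nat \<Rightarrow> nat \<Rightarrow> real"
  assumes L: "L \<ge> 0"
    and \<phi>: "\<And>j t. j \<in> {1..D} \<Longrightarrow> t \<in> {\<alpha> j..\<beta> j} \<Longrightarrow> (\<Sum>i=1..n. \<bar>\<phi> j i t\<bar>) \<le> L"
    and \<eta>: "\<And>j i. j \<in> {1..D} \<Longrightarrow> i \<in> {1..n} \<Longrightarrow> \<eta> j i \<in> {\<alpha> j..\<beta> j}"
    and step: "\<And>j \<xi>. j \<in> {1..D} \<Longrightarrow> \<xi> \<in> box_on D \<alpha> \<beta> \<Longrightarrow>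
      \<bar>f \<xi> - (\<Sum>i=1..n. \<phi> j i (\<xi> j) * f (\<xi>(j := \<eta> j i)))\<bar> \<le> \<epsilon>"
    and \<xi>: "\<xi> \<in> box_on D \<alpha> \<beta>"
  shows "m \<le> D \<Longrightarrow>
    \<bar>f \<xi> - (\<Sum>idx\<in>{1..m} \<rightarrow>\<^sub>E {1..n}. (\<Prod>j=1..m. \<phi> j (idx j) (\<xi> j)) *
        f (\<lambda>j. if j \<in> {1..m} then \<eta> j (idx j) else \<xi> j))\<bar> \<le> (\<Sum>k<m. L ^ k) * \<epsilon>"
proof (induction m)
  case 0
  show ?case by simp
next
  case (Suc m)
  define P where "P idx = (\<Prod>j=1..m. \<phi> j (idx j) (\<xi> j))" for idx
  \<comment> \<open>The first \<open>m\<close> coordinates are moved to grid nodes. The result stays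
    in the box, so \<open>step\<close> is available at every such mixed point.\<close>
  define ov where "ov idx = (\<lambda>j. if j \<in> {1..m} then \<eta> j (idx j) else \<xi> j)" for idx
  define Q where "Q = (\<Sum>idx\<in>{1..m} \<rightarrow>\<^sub>E {1..n}. P idx * f (ov idx))"
  define I where "I g = (\<Sum>i=1..n. \<phi> (Suc m) i (\<xi> (Suc m)) * f ((ov g)(Suc m := \<eta> (Suc m) i)))" for g
  have ins: "{1..Suc m} = insert (Suc m) {1..m}" by auto
  have \<xi>j: "\<xi> j \<in> {\<alpha> j..\<beta> j}" if "j \<in> {1..D}" for j
    using \<xi> that by (auto simp: box_on_def)
  have ov: "ov g \<in> box_on D \<alpha> \<beta>" if "g \<in> {1..m} \<rightarrow>\<^sub>E {1..n}" for g
  proof -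
    have "\<eta> j (g j) \<in> {\<alpha> j..\<beta> j}" if "j \<in> {1..m}" for j
      using that \<open>g \<in> _\<close> Suc.prems by (intro \<eta>) (auto simp: PiE_iff)
    then show ?thesis using \<xi> Suc.prems by (auto simp: ov_def box_on_def PiE_iff extensional_def)
  qed
  have "(\<Sum>idx\<in>{1..Suc m} \<rightarrow>\<^sub>E {1..n}. (\<Prod>j=1..Suc m. \<phi> j (idx j) (\<xi> j)) *
        f (\<lambda>j. if j \<in> {1..Suc m} then \<eta> j (idx j) else \<xi> j))
      = (\<Sum>i=1..n. \<Sum>g\<in>{1..m} \<rightarrow>\<^sub>E {1..n}. P g * (\<phi> (Suc m) i (\<xi> (Suc m)) * f ((ov g)(Suc m := \<eta> (Suc m) i))))"
    unfolding ins
  proof (subst sum_PiE_insert, simp, intro sum.cong refl)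
    fix i and g :: "nat \<Rightarrow> nat"
    have "(\<Prod>j\<in>{1..m}. \<phi> j ((g(Suc m := i)) j) (\<xi> j)) = P g"
      unfolding P_def by (intro prod.cong) auto
    then have "(\<Prod>j\<in>insert (Suc m) {1..m}. \<phi> j ((g(Suc m := i)) j) (\<xi> j))
        = \<phi> (Suc m) i (\<xi> (Suc m)) * P g"
      by (subst prod.insert) auto
    moreover have "(\<lambda>j. if j \<in> insert (Suc m) {1..m} then \<eta> j ((g(Suc m := i)) j) else \<xi> j)
        = (ov g)(Suc m := \<eta> (Suc m) i)"
      by (auto simp: ov_def)
    ultimately have "(\<Prod>j\<in>insert (Suc m) {1..m}. \<phi> j ((g(Suc m := i)) j) (\<xi> j)) *
        f (\<lambda>j. if j \<in> insert (Suc m) {1..m} then \<eta> j ((g(Suc m := i)) j) else \<xi> j)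
        = \<phi> (Suc m) i (\<xi> (Suc m)) * P g * f ((ov g)(Suc m := \<eta> (Suc m) i))"
      by (simp only:)
    then show "(\<Prod>j\<in>insert (Suc m) {1..m}. \<phi> j ((g(Suc m := i)) j) (\<xi> j)) *
        f (\<lambda>j. if j \<in> insert (Suc m) {1..m} then \<eta> j ((g(Suc m := i)) j) else \<xi> j)
        = P g * (\<phi> (Suc m) i (\<xi> (Suc m)) * f ((ov g)(Suc m := \<eta> (Suc m) i)))"
      by (simp only: mult_ac)
  qed
  also have "\<dots> = (\<Sum>g\<in>{1..m} \<rightarrow>\<^sub>E {1..n}. P g * I g)"
    unfolding I_def sum_distrib_left by (rule sum.swap)
  also have "f \<xi> - \<dots> = (f \<xi> - Q) + (\<Sum>g\<in>{1..m} \<rightarrow>\<^sub>E {1..n}. P g * (f (ov g) - I g))"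
    by (simp add: Q_def right_diff_distrib sum_subtractf)
  also have "\<bar>\<dots>\<bar> \<le> \<bar>f \<xi> - Q\<bar> + (\<Sum>g\<in>{1..m} \<rightarrow>\<^sub>E {1..n}. \<bar>P g * (f (ov g) - I g)\<bar>)"
    by (intro order_trans[OF abs_triangle_ineq] add_left_mono sum_abs)
  also have "(\<Sum>g\<in>{1..m} \<rightarrow>\<^sub>E {1..n}. \<bar>P g * (f (ov g) - I g)\<bar>) \<le> (\<Sum>g\<in>{1..m} \<rightarrow>\<^sub>E {1..n}. \<bar>P g\<bar> * \<epsilon>)"
  proof (rule sum_mono)
    fix g assume g: "g \<in> {1..m} \<rightarrow>\<^sub>E {1..n}"
    have "I g = (\<Sum>i=1..n. \<phi> (Suc m) i (ov g (Suc m)) * f ((ov g)(Suc m := \<eta> (Suc m) i)))"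
      by (simp add: I_def ov_def)
    then have "\<bar>f (ov g) - I g\<bar> \<le> \<epsilon>" using step[OF _ ov[OF g], of "Suc m"] Suc.prems by simp
    then show "\<bar>P g * (f (ov g) - I g)\<bar> \<le> \<bar>P g\<bar> * \<epsilon>" by (simp add: abs_mult mult_left_mono)
  qed
  also have "\<dots> = (\<Prod>j=1..m. \<Sum>i=1..n. \<bar>\<phi> j i (\<xi> j)\<bar>) * \<epsilon>"
    by (subst prod_sum_PiE) (auto simp: P_def abs_prod sum_distrib_right)
  also have "\<dots> \<le> (\<Prod>j=1..m. L) * \<epsilon>"
  proof (rule mult_right_mono)
    show "(\<Prod>j=1..m. \<Sum>i=1..n. \<bar>\<phi> j i (\<xi> j)\<bar>) \<le> (\<Prod>j=1..m. L)"
      using Suc.prems by (intro prod_mono conjI sum_nonneg \<phi> \<xi>j) auto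
    show "0 \<le> \<epsilon>"
      by (rule order_trans[OF abs_ge_zero step[OF _ \<xi>, of "Suc m"]]) (use Suc.prems in auto)
  qed
  also have "\<bar>f \<xi> - Q\<bar> \<le> (\<Sum>k<m. L ^ k) * \<epsilon>"
    using Suc by (simp add: Q_def P_def ov_def)
  finally show ?case by (simp add: distrib_right)
qed

section \<open>Chains of matrix products\<close>

lemma mat_chain_empty: "b < a \<Longrightarrow> mat_chain r A a b = 1\<^sub>m (r b)"
  by (simp add: mat_chain_def)

lemma mat_chain_rec: "a \<le> b \<Longrightarrow> mat_chain r A a b = A a * mat_chain r A (Suc a) b"
  by (simp add: mat_chain_def upt_conv_Cons del: upt_Suc)

lemma mat_chain_cong:
  "(\<And>j. j \<in> {a..b} \<Longrightarrow> A j = B j) \<Longrightarrow> mat_chain r A a b = mat_chain r B a b"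
  unfolding mat_chain_def by (rule foldr_cong) auto

text \<open>The bound \<open>a \<le> Suc b\<close> admits the empty chain: for
  \<open>a = Suc b\<close> it is the identity of size \<open>r b = r (a - 1)\<close>.\<close>

lemma mat_chain_carrier:
  assumes "a \<le> Suc b" and "1 \<le> a"
    and "\<And>j. j \<in> {a..b} \<Longrightarrow> A j \<in> carrier_mat (r (j - 1)) (r j)"
  shows "mat_chain r A a b \<in> carrier_mat (r (a - 1)) (r b)"
  using assms
proof (induction a rule: inc_induct)
  case base
  then show ?case by (simp add: mat_chain_empty)
next
  case (step k)
  have "A k \<in> carrier_mat (r (k - 1)) (r k)" using step by auto
  moreover have "mat_chain r A (Suc k) b \<in> carrier_mat (r k) (r b)" using step by auto
  ultimately have "A k * mat_chain r A (Suc k) b \<in> carrier_mat (r (k - 1)) (r b)"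
    by (rule mult_carrier_mat)
  then show ?case using step by (simp add: mat_chain_rec)
qed

lemma mat_chain_append:
  assumes "a \<le> Suc b" and "b \<le> c" and "1 \<le> a"
    and A: "\<And>j. j \<in> {a..c} \<Longrightarrow> A j \<in> carrier_mat (r (j - 1)) (r j)"
  shows "mat_chain r A a b * mat_chain r A (Suc b) c = mat_chain r A a c"
  using assms
proof (induction a rule: inc_induct)
  case base
  have "mat_chain r A (Suc b) c \<in> carrier_mat (r b) (r c)"
    using mat_chain_carrier[of "Suc b" c A r] base by auto
  then show ?case by (simp add: mat_chain_empty)
next
  case (step k)
  have "A k \<in> carrier_mat (r (k - 1)) (r k)" using step by auto
  moreover have "mat_chain r A (Suc k) b \<in> carrier_mat (r k) (r b)"
    using mat_chain_carrier[of "Suc k" b A r] step by auto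
  moreover have "mat_chain r A (Suc b) c \<in> carrier_mat (r b) (r c)"
    using mat_chain_carrier[of "Suc b" c A r] step by auto
  ultimately have "A k * mat_chain r A (Suc k) b * mat_chain r A (Suc b) c
      = A k * (mat_chain r A (Suc k) b * mat_chain r A (Suc b) c)"
    by (rule assoc_mult_mat)
  then show ?case using step by (simp add: mat_chain_rec)
qed

lemma index_mult_mat_sum:
  assumes "A \<in> carrier_mat m p" "B \<in> carrier_mat p q" "i < m" "j < q"
  shows "(A * B) $$ (i, j) = (\<Sum>k<p. A $$ (i, k) * B $$ (k, j))"
  using assms by (simp add: scalar_prod_def atLeast0LessThan)

text \<open>The matrix product is multilinear: each factor is a weighted sum of slices, and
  distributing yields one term per multi-index. With basis values as weights, the chain of the
  matrices \<open>pttk_A\<close> becomes a tensor interpolant with coefficients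
  \<open>tt_tensor\<close>.\<close>

lemma mat_chain_expand:
  fixes G :: "nat \<Rightarrow> nat \<Rightarrow> real mat" and w :: "nat \<Rightarrow> nat \<Rightarrow> real"
  assumes "a \<le> Suc b" and "1 \<le> a" and "p < r (a - 1)" and "q < r b"
    and G: "\<And>j i. j \<in> {a..b} \<Longrightarrow> i \<in> {1..n} \<Longrightarrow> G j i \<in> carrier_mat (r (j - 1)) (r j)"
    and A: "\<And>j. j \<in> {a..b} \<Longrightarrow>
      A j = Matrix.mat (r (j - 1)) (r j) (\<lambda>pq. \<Sum>i=1..n. w j i * G j i $$ pq)"
  shows "mat_chain r A a b $$ (p, q) = (\<Sum>idx\<in>{a..b} \<rightarrow>\<^sub>E {1..n}.
    (\<Prod>j=a..b. w j (idx j)) * mat_chain r (\<lambda>j. G j (idx j)) a b $$ (p, q))"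
  using assms
proof (induction a arbitrary: p rule: inc_induct)
  case base
  then show ?case by (simp add: mat_chain_empty)
next
  case (step k)
  have ins: "{k..b} = insert k {Suc k..b}" using step by auto
  let ?I = "{Suc k..b} \<rightarrow>\<^sub>E {1..n}"
  define C where "C g = mat_chain r (\<lambda>j. G j (g j)) (Suc k) b" for g
  define P where "P g = (\<Prod>j=Suc k..b. w j (g j))" for g
  have Ak: "A k = Matrix.mat (r (k - 1)) (r k) (\<lambda>pq. \<Sum>i=1..n. w k i * G k i $$ pq)"
    using step by auto
  have Ac: "A j \<in> carrier_mat (r (j - 1)) (r j)" if "j \<in> {k..b}" for j
    using step.prems(5)[OF that] by simp
  have cA: "mat_chain r A (Suc k) b \<in> carrier_mat (r k) (r b)"
    using mat_chain_carrier[of "Suc k" b A r] step Ac by auto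
  have cC: "C g \<in> carrier_mat (r k) (r b)" if "g \<in> ?I" for g
    using mat_chain_carrier[of "Suc k" b "\<lambda>j. G j (g j)" r] step that by (auto simp: C_def PiE_iff)
  have Gk: "G k i \<in> carrier_mat (r (k - 1)) (r k)" if "i \<in> {1..n}" for i using step that by auto
  have upd: "mat_chain r (\<lambda>j. G j ((g(k := i)) j)) k b = G k i * C g"
    and updP: "(\<Prod>j=k..b. w j ((g(k := i)) j)) = w k i * P g" for g i
  proof -
    have "mat_chain r (\<lambda>j. G j ((g(k := i)) j)) (Suc k) b = C g"
      unfolding C_def by (rule mat_chain_cong) auto
    then show "mat_chain r (\<lambda>j. G j ((g(k := i)) j)) k b = G k i * C g"
      using step by (simp add: mat_chain_rec)
    have "(\<Prod>j=Suc k..b. w j ((g(k := i)) j)) = P g"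
      unfolding P_def by (intro prod.cong) auto
    then show "(\<Prod>j=k..b. w j ((g(k := i)) j)) = w k i * P g"
      unfolding ins by (subst prod.insert) auto
  qed
  \<comment> \<open>Peeling off the first factor meets every row \<open>l\<close> of the remaining
    chain, which is why the induction keeps the row arbitrary.\<close>
  have IH: "mat_chain r A (Suc k) b $$ (l, q) = (\<Sum>g\<in>?I. P g * C g $$ (l, q))" if "l < r k" for l
    unfolding P_def C_def using step that by (intro step.IH) auto
  have "mat_chain r A k b $$ (p, q) = (\<Sum>l<r k. A k $$ (p, l) * mat_chain r A (Suc k) b $$ (l, q))"
    using step.hyps step.prems(2,3) index_mult_mat_sum[OF Ac[of k] cA] by (simp add: mat_chain_rec)
  also have "\<dots> = (\<Sum>l<r k. (\<Sum>i=1..n. w k i * G k i $$ (p, l)) * (\<Sum>g\<in>?I. P g * C g $$ (l, q)))"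
    using step.prems by (intro sum.cong refl) (simp add: Ak IH)
  also have "\<dots> = (\<Sum>l<r k. \<Sum>i=1..n. \<Sum>g\<in>?I. w k i * P g * (G k i $$ (p, l) * C g $$ (l, q)))"
    by (intro sum.cong refl) (simp add: sum_product mult_ac)
  also have "\<dots> = (\<Sum>i=1..n. \<Sum>l<r k. \<Sum>g\<in>?I. w k i * P g * (G k i $$ (p, l) * C g $$ (l, q)))"
    by (rule sum.swap)
  also have "\<dots> = (\<Sum>i=1..n. \<Sum>g\<in>?I. \<Sum>l<r k. w k i * P g * (G k i $$ (p, l) * C g $$ (l, q)))"
    by (intro sum.cong refl sum.swap)
  also have "\<dots> = (\<Sum>i=1..n. \<Sum>g\<in>?I. w k i * P g * (G k i * C g) $$ (p, q))"
  proof (intro sum.cong refl)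
    fix i g assume "i \<in> {1..n}" "g \<in> ?I"
    then show "(\<Sum>l<r k. w k i * P g * (G k i $$ (p, l) * C g $$ (l, q))) = w k i * P g * (G k i * C g) $$ (p, q)"
      using step.prems by (simp add: index_mult_mat_sum[OF Gk cC] sum_distrib_left)
  qed
  also have "\<dots> = (\<Sum>idx\<in>{k..b} \<rightarrow>\<^sub>E {1..n}. (\<Prod>j=k..b. w j (idx j)) * mat_chain r (\<lambda>j. G j (idx j)) k b $$ (p, q))"
  proof -
    have "(\<Sum>idx\<in>{k..b} \<rightarrow>\<^sub>E {1..n}. (\<Prod>j=k..b. w j (idx j)) * mat_chain r (\<lambda>j. G j (idx j)) k b $$ (p, q))
        = (\<Sum>i=1..n. \<Sum>g\<in>?I. (\<Prod>j=k..b. w j ((g(k := i)) j)) * mat_chain r (\<lambda>j. G j ((g(k := i)) j)) k b $$ (p, q))"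
      unfolding ins by (rule sum_PiE_insert) simp
    then show ?thesis unfolding upd updP by simp
  qed
  finally show ?case .
qed

section \<open>Maximum norms and compactness of the box\<close>

lemma abs_le_max_abs: "finite I \<Longrightarrow> i \<in> I \<Longrightarrow> \<bar>g i\<bar> \<le> max_abs I g"
  unfolding max_abs_def by (intro Max_ge) auto

lemma max_abs_le: "finite I \<Longrightarrow> 0 \<le> c \<Longrightarrow> (\<And>i. i \<in> I \<Longrightarrow> \<bar>g i\<bar> \<le> c) \<Longrightarrow> max_abs I g \<le> c"
  unfolding max_abs_def by (subst Max_le_iff) auto

lemma max_abs_cong: "(\<And>i. i \<in> I \<Longrightarrow> g i = h i) \<Longrightarrow> max_abs I g = max_abs I h"
  unfolding max_abs_def by simp

lemma continuous_on_max_abs: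
  assumes "finite I" "\<And>i. i \<in> I \<Longrightarrow> continuous_on S (\<lambda>x. g x i)"
  shows "continuous_on S (\<lambda>x. max_abs I (g x))"
  using assms
proof (induction I rule: finite_induct)
  case empty
  show ?case by (simp add: max_abs_def)
next
  case (insert i I)
  have "max_abs (insert i I) h = max \<bar>h i\<bar> (max_abs I h)" for h :: "'a \<Rightarrow> real"
    unfolding max_abs_def using insert.hyps by (simp add: insert_commute[of 0])
  then show ?case using insert by (simp add: continuous_on_max continuous_on_rabs)
qed

text \<open>In the product topology on all of \<open>nat \<Rightarrow> real\<close> the box is a
  full product whose factors off \<open>{1..m}\<close> are the compact singleton of
  \<open>undefined\<close>, so Tychonoff's theorem applies.\<close>

lemma compact_box_on: "compact (box_on m \<alpha> \<beta>)"
proof -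
  have "box_on m \<alpha> \<beta> = Pi\<^sub>E UNIV (\<lambda>i. if i \<in> {1..m} then {\<alpha> i..\<beta> i} else {undefined})"
    by (auto simp: box_on_def PiE_iff extensional_def split: if_splits)
  moreover have "compactin (product_topology (\<lambda>i. euclidean) UNIV)
      (Pi\<^sub>E UNIV (\<lambda>i::nat. if i \<in> {1..m} then {\<alpha> i..\<beta> i} else {undefined}))"
    unfolding compactin_PiE by auto
  ultimately show ?thesis by (simp add: euclidean_product_topology)
qed

section \<open>The PTTK error\<close>

lemma fun_upd_in_box_on:
  assumes "\<xi> \<in> box_on m \<alpha> \<beta>" "j \<in> {1..m}" "t \<in> {\<alpha> j..\<beta> j}"
  shows "\<xi>(j := t) \<in> box_on m \<alpha> \<beta>"
  using assms by (auto simp: box_on_def PiE_iff extensional_def)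

text \<open>A constant list of coordinates turns the mixed derivatives in
  \<open>smooth_on_box\<close> into pure ones, and a second update at \<open>j\<close> overwrites
  the first. The result is the sequence of derivatives that
  \<open>factorial_derivative_bounds\<close> asks for.\<close>

lemma smooth_on_box_slice:
  assumes smooth: "smooth_on_box m \<alpha> \<beta> f" and j: "j \<in> {1..m}" and \<xi>: "\<xi> \<in> box_on m \<alpha> \<beta>"
    and t: "t \<in> {\<alpha> j..\<beta> j}"
  shows "((\<lambda>s. (partial_deriv \<alpha> \<beta> j ^^ v) f (\<xi>(j := s))) has_field_derivative
    (partial_deriv \<alpha> \<beta> j ^^ Suc v) f (\<xi>(j := t))) (at t within {\<alpha> j..\<beta> j})"
proof -
  have fold: "fold (partial_deriv \<alpha> \<beta>) (replicate v j) f = (partial_deriv \<alpha> \<beta> j ^^ v) f"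
    by (induction v arbitrary: f) (simp_all add: funpow_swap1)
  have "set (replicate v j) \<subseteq> {1..m}" using j by auto
  then have "(\<lambda>s. fold (partial_deriv \<alpha> \<beta>) (replicate v j) f ((\<xi>(j := t))(j := s)))
      differentiable (at ((\<xi>(j := t)) j) within {\<alpha> j..\<beta> j})"
    using smooth j fun_upd_in_box_on[OF \<xi> j t] unfolding smooth_on_box_def by blast
  then have "(\<lambda>s. (partial_deriv \<alpha> \<beta> j ^^ v) f (\<xi>(j := s))) differentiable (at t within {\<alpha> j..\<beta> j})"
    by (simp add: fold)
  then show ?thesis
    unfolding has_real_derivative_iff_has_vector_derivative vector_derivative_works
    by (simp add: partial_deriv_def)
qed

lemma diam_inf_ge: "i \<in> {1..m} \<Longrightarrow> \<beta> i - \<alpha> i \<le> diam_inf m \<alpha> \<beta>"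
  unfolding diam_inf_def by (intro Max_ge) auto

text \<open>
  On a side shorter than the diameter the radius \<open>\<gamma>\<close> is shrunk in proportion, so that all sides have
  the same ratio of radius to length.
\<close>

lemma coordinate_interpolation_error:
  assumes n: "n \<ge> 1" and C: "C \<ge> 0" and \<gamma>: "\<gamma> > 0" and \<sigma>: "\<sigma> \<ge> 1"
    and intervals: "\<And>i. i \<in> {1..D} \<Longrightarrow> \<alpha> i < \<beta> i"
    and smooth: "smooth_on_box D \<alpha> \<beta> f"
    and bound: "\<And>i v \<xi>. i \<in> {1..D} \<Longrightarrow> \<xi> \<in> box_on D \<alpha> \<beta> \<Longrightarrow>
      \<bar>(partial_deriv \<alpha> \<beta> i ^^ v) f \<xi>\<bar> \<le> C * fact (v + \<sigma> - 1) / (\<gamma> ^ v * fact (\<sigma> - 1))"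
    and nodes: "bij_betw \<zeta> {1..n} (cheb_nodes n)"
    and j: "j \<in> {1..D}" and \<xi>: "\<xi> \<in> box_on D \<alpha> \<beta>"
  shows "\<bar>f \<xi> - (\<Sum>i=1..n. cheb_basis n \<zeta> (\<alpha> j) (\<beta> j) i (\<xi> j) * f (\<xi>(j := affine_map (\<alpha> j) (\<beta> j) (\<zeta> i))))\<bar>
    \<le> (lebesgue_const (n - 1) + 1) * (2 * exp 1 * C * (real n + 1) ^ \<sigma> *
        (1 + diam_inf D \<alpha> \<beta> / \<gamma>) * varsigma (2 * \<gamma> / diam_inf D \<alpha> \<beta>) powi (- int n))"
proof -
  define \<delta> where "\<delta> = diam_inf D \<alpha> \<beta>"
  define l where "l = \<beta> j - \<alpha> j"
  define \<gamma>' where "\<gamma>' = \<gamma> * (l / \<delta>)"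
  have l: "0 < l" "l \<le> \<delta>" using intervals[OF j] diam_inf_ge[OF j] by (auto simp: l_def \<delta>_def)
  have "0 < l / \<delta>" "l / \<delta> \<le> 1" using l by auto
  then have \<gamma>': "0 < \<gamma>'" "\<gamma>' \<le> \<gamma>"
    using mult_pos_pos[OF \<gamma>, of "l / \<delta>"] mult_left_mono[of "l / \<delta>" 1 \<gamma>] \<gamma> unfolding \<gamma>'_def by auto
  define U where "U v t = (partial_deriv \<alpha> \<beta> j ^^ v) f (\<xi>(j := t))" for v t
  interpret factorial_derivative_bounds "\<alpha> j" "\<beta> j" C \<gamma>' \<sigma> U
  proof
    show "(U v has_field_derivative U (Suc v) t) (at t within {\<alpha> j..\<beta> j})" if "t \<in> {\<alpha> j..\<beta> j}" for v t
      unfolding U_def using smooth_on_box_slice[OF smooth j \<xi> that] .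
    show "\<bar>U v t\<bar> \<le> C * fact (v + \<sigma> - 1) / (\<gamma>' ^ v * fact (\<sigma> - 1))" if "t \<in> {\<alpha> j..\<beta> j}" for v t
    proof -
      have "\<bar>U v t\<bar> \<le> C * fact (v + \<sigma> - 1) / (\<gamma> ^ v * fact (\<sigma> - 1))"
        unfolding U_def by (intro bound j fun_upd_in_box_on \<xi> that)
      also have "\<dots> \<le> C * fact (v + \<sigma> - 1) / (\<gamma>' ^ v * fact (\<sigma> - 1))"
        using C \<gamma> \<gamma>' by (intro divide_left_mono mult_right_mono power_mono mult_pos_pos) auto
      finally show ?thesis .
    qed
  qed (use intervals[OF j] C \<sigma> \<gamma>' in auto)
  have g: "2 * \<gamma>' / (\<beta> j - \<alpha> j) = 2 * \<gamma> / \<delta>"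
    unfolding l_def[symmetric] using l by (simp add: \<gamma>'_def)
  obtain c where c: "\<And>z. z \<in> {-1..1} \<Longrightarrow>
      \<bar>U 0 (affine_map (\<alpha> j) (\<beta> j) z) - (\<Sum>k<n. c k * cos (real k * arccos z))\<bar>
      \<le> 2 * exp 1 * C * (real n + 1) ^ \<sigma> * (1 + 2 / (2 * \<gamma> / \<delta>)) * varsigma (2 * \<gamma> / \<delta>) powi (- int n)"
    using chebyshev_approximation[OF n] unfolding g by blast
  \<comment> \<open>The summand \<open>2 / g\<close> of the radius tradeoff becomes the diameter
    over \<open>\<gamma>\<close>.\<close>
  have "2 / (2 * \<gamma> / \<delta>) = \<delta> / \<gamma>" by simp
  note c = c[unfolded this, folded cheb_T_def]
  have "\<xi> j \<in> {\<alpha> j..\<beta> j}" using \<xi> j by (auto simp: box_on_def)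
  from cheb_interpolation_error[OF n intervals[OF j] this nodes c]
  show ?thesis by (simp add: U_def \<delta>_def)
qed

text \<open>In the tensor argument the error of the step after \<open>k\<close> interpolated
  coordinates is amplified by \<open>L ^ k\<close>, and each univariate step costs
  \<open>L + 1\<close>. For \<open>k < m\<close> the product of the two is at most
  \<open>(L + 1) ^ m\<close>; this explains the factor \<open>D * (\<lambda> + 1) ^ D\<close> of the
  error bound.\<close>

lemma sum_power_le:
  fixes L :: real
  assumes "L \<ge> 0"
  shows "(\<Sum>k<m. L ^ k) * (L + 1) \<le> real m * (L + 1) ^ m"
proof -
  have "(\<Sum>k<m. L ^ k * (L + 1)) \<le> (\<Sum>k<m. (L + 1) ^ m)"
  proof (rule sum_mono)
    fix k assume "k \<in> {..<m}"
    have "L ^ k * (L + 1) \<le> (L + 1) ^ k * (L + 1)"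
      using assms by (intro mult_right_mono power_mono) auto
    also have "\<dots> = (L + 1) ^ Suc k" by simp
    also have "\<dots> \<le> (L + 1) ^ m" using assms \<open>k \<in> {..<m}\<close> by (intro power_increasing) auto
    finally show "L ^ k * (L + 1) \<le> (L + 1) ^ m" .
  qed
  then show ?thesis by (simp add: sum_distrib_right)
qed

lemma chebyshev_tensor_interpolation_error:
  assumes n: "n \<ge> 1" and C: "C \<ge> 0" and \<gamma>: "\<gamma> > 0" and \<sigma>: "\<sigma> \<ge> 1"
    and intervals: "\<And>i. i \<in> {1..D} \<Longrightarrow> \<alpha> i < \<beta> i"
    and smooth: "smooth_on_box D \<alpha> \<beta> f"
    and bound: "\<And>i v \<xi>. i \<in> {1..D} \<Longrightarrow> \<xi> \<in> box_on D \<alpha> \<beta> \<Longrightarrow>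
      \<bar>(partial_deriv \<alpha> \<beta> i ^^ v) f \<xi>\<bar> \<le> C * fact (v + \<sigma> - 1) / (\<gamma> ^ v * fact (\<sigma> - 1))"
    and nodes: "bij_betw \<zeta> {1..n} (cheb_nodes n)"
    and D: "D \<ge> 1" and \<xi>: "\<xi> \<in> box_on D \<alpha> \<beta>"
  shows "\<bar>f \<xi> - (\<Sum>idx\<in>{1..D} \<rightarrow>\<^sub>E {1..n}.
      (\<Prod>j=1..D. cheb_basis n \<zeta> (\<alpha> j) (\<beta> j) (idx j) (\<xi> j)) * coeff_tensor D \<alpha> \<beta> \<zeta> f idx)\<bar>
    \<le> cheb_err D \<alpha> \<beta> C \<gamma> \<sigma> n"
proof -
  define L where "L = lebesgue_const (n - 1)"
  define e where "e = 2 * exp 1 * C * (real n + 1) ^ \<sigma> *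
        (1 + diam_inf D \<alpha> \<beta> / \<gamma>) * varsigma (2 * \<gamma> / diam_inf D \<alpha> \<beta>) powi (- int n)"
  have L: "L \<ge> 0" using lebesgue_const_nonneg[OF n] by (simp add: L_def)
  have "0 < diam_inf D \<alpha> \<beta>" using D intervals[of 1] diam_inf_ge[of 1 D \<beta> \<alpha>] by auto
  then have e: "e \<ge> 0"
    unfolding e_def using C \<gamma> varsigma_pos[of "2 * \<gamma> / diam_inf D \<alpha> \<beta>"]
    by (intro mult_nonneg_nonneg zero_le_power add_nonneg_nonneg) auto
  have \<zeta>: "affine_map (\<alpha> j) (\<beta> j) (\<zeta> i) \<in> {\<alpha> j..\<beta> j}" if "j \<in> {1..D}" "i \<in> {1..n}" for i j
    using bij_betwE[OF nodes] that intervals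
    by (intro affine_map_in_interval) (auto simp: cheb_nodes_def)
  \<comment> \<open>Once all \<open>D\<close> coordinates are at nodes, \<open>\<xi>\<close>
    survives only off \<open>{1..D}\<close>, where it is \<open>undefined\<close> like the
    restricted grid point in \<open>coeff_tensor\<close>.\<close>
  have "(\<lambda>j. if j \<in> {1..D} then affine_map (\<alpha> j) (\<beta> j) (\<zeta> (idx j)) else \<xi> j)
      = (\<lambda>j\<in>{1..D}. affine_map (\<alpha> j) (\<beta> j) (\<zeta> (idx j)))" for idx
    using \<xi> by (auto simp: box_on_def PiE_iff extensional_def restrict_def)
  then have "\<bar>f \<xi> - (\<Sum>idx\<in>{1..D} \<rightarrow>\<^sub>E {1..n}.
      (\<Prod>j=1..D. cheb_basis n \<zeta> (\<alpha> j) (\<beta> j) (idx j) (\<xi> j)) * coeff_tensor D \<alpha> \<beta> \<zeta> f idx)\<bar>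
      \<le> (\<Sum>k<D. L ^ k) * ((L + 1) * e)"
    using tensor_interpolation_error[where L = L and D = D and \<alpha> = \<alpha> and \<beta> = \<beta> and n = n
        and \<phi> = "\<lambda>j. cheb_basis n \<zeta> (\<alpha> j) (\<beta> j)" and f = f and \<epsilon> = "(L + 1) * e" and \<xi> = \<xi>
        and \<eta> = "\<lambda>j i. affine_map (\<alpha> j) (\<beta> j) (\<zeta> i)" and m = D]
      L \<zeta> sum_abs_cheb_basis_le[OF n intervals _ nodes] \<xi>
      coordinate_interpolation_error[OF n C \<gamma> \<sigma> intervals smooth bound nodes]
    unfolding L_def e_def coeff_tensor_def by simp
  also have "\<dots> \<le> real D * (L + 1) ^ D * e"
    using mult_right_mono[OF sum_power_le[OF L, of D] e] by (simp add: mult.assoc)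
  also have "\<dots> = cheb_err D \<alpha> \<beta> C \<gamma> \<sigma> n"
    by (simp add: cheb_err_def e_def L_def mult_ac)
  finally show ?thesis .
qed

text \<open>The weights are products, so their absolute sum over the grid is the product of
  \<open>D\<close> univariate sums, each at most the Lebesgue constant.\<close>

lemma weighted_tensor_bound:
  assumes n: "n \<ge> 1" and intervals: "\<And>i. i \<in> {1..D} \<Longrightarrow> \<alpha> i < \<beta> i"
    and nodes: "bij_betw \<zeta> {1..n} (cheb_nodes n)" and \<xi>: "\<xi> \<in> box_on D \<alpha> \<beta>"
  shows "\<bar>\<Sum>idx\<in>{1..D} \<rightarrow>\<^sub>E {1..n}. (\<Prod>j=1..D. cheb_basis n \<zeta> (\<alpha> j) (\<beta> j) (idx j) (\<xi> j)) * E idx\<bar>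
    \<le> lebesgue_const (n - 1) ^ D * tensor_norm_C D n E"
proof -
  let ?I = "{1..D} \<rightarrow>\<^sub>E {1..n}"
  have fin: "finite ?I" by (intro finite_PiE) auto
  have \<xi>j: "\<xi> j \<in> {\<alpha> j..\<beta> j}" if "j \<in> {1..D}" for j using \<xi> that by (auto simp: box_on_def)
  have "\<bar>\<Sum>idx\<in>?I. (\<Prod>j=1..D. cheb_basis n \<zeta> (\<alpha> j) (\<beta> j) (idx j) (\<xi> j)) * E idx\<bar>
      \<le> (\<Sum>idx\<in>?I. (\<Prod>j=1..D. \<bar>cheb_basis n \<zeta> (\<alpha> j) (\<beta> j) (idx j) (\<xi> j)\<bar>) * tensor_norm_C D n E)"
    unfolding tensor_norm_C_def
    by (rule order_trans[OF sum_abs], rule sum_mono, unfold abs_mult abs_prod,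
        rule mult_left_mono[OF abs_le_max_abs[OF fin] prod_nonneg]) auto
  also have "\<dots> = (\<Prod>j=1..D. \<Sum>i=1..n. \<bar>cheb_basis n \<zeta> (\<alpha> j) (\<beta> j) i (\<xi> j)\<bar>) * tensor_norm_C D n E"
    by (subst prod_sum_PiE) (auto simp: sum_distrib_right)
  also have "\<dots> \<le> (\<Prod>j=1..D. lebesgue_const (n - 1)) * tensor_norm_C D n E"
  proof (rule mult_right_mono)
    show "(\<Prod>j=1..D. \<Sum>i=1..n. \<bar>cheb_basis n \<zeta> (\<alpha> j) (\<beta> j) i (\<xi> j)\<bar>) \<le> (\<Prod>j=1..D. lebesgue_const (n - 1))"
      by (intro prod_mono conjI sum_nonneg sum_abs_cheb_basis_le[OF n intervals \<xi>j nodes]) auto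
    show "0 \<le> tensor_norm_C D n E"
      unfolding tensor_norm_C_def max_abs_def using fin by (intro Max_ge) auto
  qed
  finally show ?thesis by simp
qed

section \<open>Entries of the PTTK product\<close>

lemma index_mult_mat_sum3:
  assumes "A \<in> carrier_mat m p" "B \<in> carrier_mat p q" "C \<in> carrier_mat q s" "i < m" "j < s"
  shows "(A * B * C) $$ (i, j) = (\<Sum>l<q. (\<Sum>k<p. A $$ (i, k) * B $$ (k, l)) * C $$ (l, j))"
  using index_mult_mat_sum[OF mult_carrier_mat[OF assms(1,2)] assms(3-5)]
  by (simp add: index_mult_mat_sum[OF assms(1,2,4)])

text \<open>The coordinates come in the order of the tensor modes. The restriction makes the point
  extensional, as membership in \<open>box_on\<close> requires.\<close>

definition concat_points :: "nat \<Rightarrow> nat \<Rightarrow> (nat \<Rightarrow> real) \<Rightarrow> (nat \<Rightarrow> real) \<Rightarrow> (nat \<Rightarrow> real) \<Rightarrow> nat \<Rightarrow> real" where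
  "concat_points d p x \<theta> y = (\<lambda>j\<in>{1..2 * d + p}.
     if j \<le> d then x j else if j \<le> d + p then \<theta> (j - d) else y (j - (d + p)))"

lemma concat_points_in_box_on:
  assumes x: "x \<in> box_on d \<alpha> \<beta>"
    and \<theta>: "\<theta> \<in> box_on p (\<lambda>i. \<alpha> (d + i)) (\<lambda>i. \<beta> (d + i))"
    and y: "y \<in> box_on d (\<lambda>i. \<alpha> (d + p + i)) (\<lambda>i. \<beta> (d + p + i))"
  shows "concat_points d p x \<theta> y \<in> box_on (2 * d + p) \<alpha> \<beta>"
  unfolding box_on_def
proof (rule PiE_I)
  fix j assume j: "j \<in> {1..2 * d + p}"
  consider "j \<le> d" | "d < j" "j \<le> d + p" | "d + p < j" by linarith
  then show "concat_points d p x \<theta> y j \<in> {\<alpha> j..\<beta> j}"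
  proof cases
    case 1
    then show ?thesis using j PiE_mem[OF x[unfolded box_on_def], of j] by (simp add: concat_points_def)
  next
    case 2
    then have "j - d \<in> {1..p}" unfolding atLeastAtMost_iff by linarith
    then show ?thesis using 2 j PiE_mem[OF \<theta>[unfolded box_on_def], of "j - d"] by (simp add: concat_points_def)
  next
    case 3
    then have "j - (d + p) \<in> {1..d}" using j unfolding atLeastAtMost_iff by linarith
    then show ?thesis using 3 j PiE_mem[OF y[unfolded box_on_def], of "j - (d + p)"] by (simp add: concat_points_def)
  qed
qed (auto simp: concat_points_def)

text \<open>Restricting the coordinates of the concatenation gives back \<open>x\<close>,
  \<open>y\<close> and \<open>\<theta>\<close> as functions, because all three are
  \<open>undefined\<close> off their index sets.\<close>

lemma kernel_fun_concat_points:
  assumes x: "x \<in> box_on d \<alpha> \<beta>" and \<theta>: "\<theta> \<in> box_on p \<alpha>' \<beta>'" and y: "y \<in> box_on d \<alpha>'' \<beta>''"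
  shows "kernel_fun d p \<kappa> (concat_points d p x \<theta> y) = \<kappa> x y \<theta>"
proof -
  have "(\<lambda>i\<in>{1..d}. concat_points d p x \<theta> y i) = x"
    using x by (auto simp: concat_points_def box_on_def PiE_iff extensional_def fun_eq_iff)
  moreover have "(\<lambda>i\<in>{1..d}. concat_points d p x \<theta> y (d + p + i)) = y"
    using y by (auto simp: concat_points_def box_on_def PiE_iff extensional_def fun_eq_iff)
  moreover have "(\<lambda>i\<in>{1..p}. concat_points d p x \<theta> y (d + i)) = \<theta>"
    using \<theta> by (auto simp: concat_points_def box_on_def PiE_iff extensional_def fun_eq_iff)
  ultimately show ?thesis by (simp add: kernel_fun_def)
qed

lemma continuous_on_concat_points: "continuous_on S (\<lambda>\<theta>. concat_points d p x \<theta> y)"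
proof (rule continuous_on_coordinatewise_then_product)
  fix j
  show "continuous_on S (\<lambda>\<theta>. concat_points d p x \<theta> y j)"
    by (cases "j \<in> {1..2 * d + p}"; cases "j \<le> d"; cases "j \<le> d + p")
      (simp_all add: concat_points_def continuous_on_subset[OF continuous_on_product_coordinates])
qed

text \<open>A row of \<open>S\<close>, the matrix \<open>H\<close> and a column of the transpose of
  \<open>T\<close> are consecutive pieces of one chain over all modes, evaluated at the concatenated
  point. Joined, they form a 1 by 1 matrix, since the outer ranks are 1, and
  \<open>mat_chain_expand\<close> applies to its entry.\<close>

lemma pttk_entry:
  fixes G :: "nat \<Rightarrow> nat \<Rightarrow> real mat"
  assumes cores: "tt_cores (2 * d + p) n r G" and "a < N\<^sub>s" "b < N\<^sub>t"
    and A_def: "A = pttk_A n \<alpha> \<beta> \<zeta> r G"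
  shows "(pttk_S r A d N\<^sub>s x * pttk_H r A d p \<theta> * transpose_mat (pttk_T r A d p N\<^sub>t y)) $$ (a, b)
    = (\<Sum>idx\<in>{1..2 * d + p} \<rightarrow>\<^sub>E {1..n}.
        (\<Prod>j=1..2 * d + p. cheb_basis n \<zeta> (\<alpha> j) (\<beta> j) (idx j) (concat_points d p (x a) \<theta> (y b) j))
          * tt_tensor (2 * d + p) r G idx)"
proof -
  define D where "D = 2 * d + p"
  define B where "B j = A j (concat_points d p (x a) \<theta> (y b) j)" for j
  define C1 where "C1 = mat_chain r B 1 d"
  define C2 where "C2 = mat_chain r B (d + 1) (d + p)"
  define C3 where "C3 = mat_chain r B (d + p + 1) D"
  have r: "r 0 = 1" "r D = 1" using cores by (auto simp: tt_cores_def D_def)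
  have A: "A j t \<in> carrier_mat (r (j - 1)) (r j)" for j t by (simp add: A_def pttk_A_def)
  then have B: "B j \<in> carrier_mat (r (j - 1)) (r j)" for j by (simp add: B_def)
  have c: "C1 \<in> carrier_mat 1 (r d)" "C2 \<in> carrier_mat (r d) (r (d + p))" "C3 \<in> carrier_mat (r (d + p)) 1"
    using mat_chain_carrier[of 1 d B r, OF _ _ B] mat_chain_carrier[of "d + 1" "d + p" B r, OF _ _ B]
      mat_chain_carrier[of "d + p + 1" D B r, OF _ _ B] r
    by (auto simp: C1_def C2_def C3_def D_def)
  have e1: "mat_chain r (\<lambda>j. A j (x a j)) 1 d = C1"
    unfolding C1_def B_def by (rule mat_chain_cong) (simp add: concat_points_def)
  have e2: "pttk_H r A d p \<theta> = C2"
    unfolding C2_def B_def pttk_H_def by (rule mat_chain_cong) (auto simp: concat_points_def)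
  have e3: "mat_chain r (\<lambda>j. A j (y b (j - (d + p)))) (d + p + 1) (2 * d + p) = C3"
    unfolding C3_def B_def D_def by (rule mat_chain_cong) (auto simp: concat_points_def)
  define S where "S = pttk_S r A d N\<^sub>s x"
  define T where "T = transpose_mat (pttk_T r A d p N\<^sub>t y)"
  have S: "S \<in> carrier_mat N\<^sub>s (r d)" by (simp add: S_def pttk_S_def mat_of_rows_def)
  have T: "T \<in> carrier_mat (r (d + p)) N\<^sub>t" by (simp add: T_def pttk_T_def mat_of_cols_def)
  have Sa: "S $$ (a, k) = C1 $$ (0, k)" if "k < r d" for k
    using that c(1) \<open>a < N\<^sub>s\<close> by (simp add: S_def pttk_S_def mat_of_rows_index e1[unfolded One_nat_def])
  have Tb: "T $$ (l, b) = C3 $$ (l, 0)" if "l < r (d + p)" for l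
    using that c(3) \<open>b < N\<^sub>t\<close> by (simp add: T_def pttk_T_def mat_of_cols_index e3[unfolded Suc_eq_plus1[symmetric]])
  have "(S * C2 * T) $$ (a, b) = (C1 * C2 * C3) $$ (0, 0)"
    using index_mult_mat_sum3[OF S c(2) T \<open>a < N\<^sub>s\<close> \<open>b < N\<^sub>t\<close>] index_mult_mat_sum3[OF c, of 0 0]
    by (simp add: Sa Tb)
  also have "C1 * C2 = mat_chain r B 1 (d + p)"
    unfolding C1_def C2_def Suc_eq_plus1[symmetric] by (rule mat_chain_append) (use B in auto)
  also have "mat_chain r B 1 (d + p) * C3 = mat_chain r B 1 D"
    unfolding C3_def Suc_eq_plus1[symmetric] by (rule mat_chain_append) (use B in \<open>auto simp: D_def\<close>)
  also have "mat_chain r B 1 D $$ (0, 0) = (\<Sum>idx\<in>{1..D} \<rightarrow>\<^sub>E {1..n}.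
      (\<Prod>j=1..D. cheb_basis n \<zeta> (\<alpha> j) (\<beta> j) (idx j) (concat_points d p (x a) \<theta> (y b) j))
        * mat_chain r (\<lambda>j. G j (idx j)) 1 D $$ (0, 0))"
    using cores r by (intro mat_chain_expand) (auto simp: tt_cores_def D_def B_def A_def pttk_A_def)
  finally show ?thesis unfolding S_def T_def e2 tt_tensor_def D_def .
qed

lemma box_on_nonempty:
  assumes "\<And>i. i \<in> {1..m} \<Longrightarrow> \<alpha> i \<le> \<beta> i"
  shows "box_on m \<alpha> \<beta> \<noteq> {}"
  using assms by (auto simp: box_on_def PiE_eq_empty_iff)

lemma continuous_on_box_coordinate:
  assumes "continuous_on S g" "g ` S \<subseteq> box_on m \<alpha> \<beta>" "j \<in> {1..m}" "continuous_on {\<alpha> j..\<beta> j} h"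
  shows "continuous_on S (\<lambda>x. h (g x j))"
proof (rule continuous_on_compose2[OF assms(4)])
  show "continuous_on S (\<lambda>x. g x j)"
    by (rule continuous_on_product_then_coordinatewise[OF assms(1)])
  show "(\<lambda>x. g x j) ` S \<subseteq> {\<alpha> j..\<beta> j}"
    using assms(2,3) by (auto simp: box_on_def image_subset_iff PiE_iff)
qed

text \<open>The maximum over \<open>\<Theta>\<close> is rendered by a maximiser
  \<open>\<theta>\<^sub>m\<close> together with the bound at this point, so attainment of the
  maximum is part of the claim.\<close>

theorem proposition3p1:
  fixes d d\<^sub>\<theta> D n N\<^sub>s N\<^sub>t \<sigma> :: nat
    and \<alpha> \<beta> \<zeta> :: "nat \<Rightarrow> real"
    and x y :: "nat \<Rightarrow> nat \<Rightarrow> real"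
    and \<kappa> :: kernel
    and f :: "(nat \<Rightarrow> real) \<Rightarrow> real"
    and B\<^sub>s \<Theta> B\<^sub>t \<Xi> :: "(nat \<Rightarrow> real) set"
    and C\<^sub>f \<gamma>\<^sub>f :: real
    and r :: "nat \<Rightarrow> nat"
    and G :: "nat \<Rightarrow> nat \<Rightarrow> real mat"
    and M M' :: "(nat \<Rightarrow> nat) \<Rightarrow> real"
    and A :: "nat \<Rightarrow> real \<Rightarrow> real mat"
    and S T :: "real mat"
    and H K :: "(nat \<Rightarrow> real) \<Rightarrow> real mat"
  assumes "d \<ge> 1" and "d\<^sub>\<theta> \<ge> 1" and "n \<ge> 1"
    and D: "D = 2 * d + d\<^sub>\<theta>"
    and intervals: "\<And>i. i \<in> {1..D} \<Longrightarrow> \<alpha> i < \<beta> i"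
    and Bs: "B\<^sub>s = box_on d \<alpha> \<beta>"
    and Theta: "\<Theta> = box_on d\<^sub>\<theta> (\<lambda>i. \<alpha> (d + i)) (\<lambda>i. \<beta> (d + i))"
    and Bt: "B\<^sub>t = box_on d (\<lambda>i. \<alpha> (d + d\<^sub>\<theta> + i)) (\<lambda>i. \<beta> (d + d\<^sub>\<theta> + i))"
    and Xi: "\<Xi> = box_on D \<alpha> \<beta>"
    and X: "\<And>a. a < N\<^sub>s \<Longrightarrow> x a \<in> B\<^sub>s"
    and Y: "\<And>b. b < N\<^sub>t \<Longrightarrow> y b \<in> B\<^sub>t"
    and f: "f = kernel_fun d d\<^sub>\<theta> \<kappa>"
    and smooth: "smooth_on_box D \<alpha> \<beta> f"
    and "C\<^sub>f \<ge> 0" and "\<gamma>\<^sub>f > 0" and "\<sigma> \<ge> 1"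
    and bound: "\<And>i v \<xi>. i \<in> {1..D} \<Longrightarrow> \<xi> \<in> \<Xi> \<Longrightarrow>
      \<bar>(partial_deriv \<alpha> \<beta> i ^^ v) f \<xi>\<bar>
        \<le> C\<^sub>f * fact (v + \<sigma> - 1) / (\<gamma>\<^sub>f ^ v * fact (\<sigma> - 1))"
    and nodes: "bij_betw \<zeta> {1..n} (cheb_nodes n)"
    and M: "M = coeff_tensor D \<alpha> \<beta> \<zeta> f"
    and cores: "tt_cores D n r G"
    and M': "M' = tt_tensor D r G"
    and K: "K = kernel_mat \<kappa> N\<^sub>s N\<^sub>t x y"
    and A: "A = pttk_A n \<alpha> \<beta> \<zeta> r G"
    and S: "S = pttk_S r A d N\<^sub>s x"
    and H: "H = pttk_H r A d d\<^sub>\<theta>"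
    and T: "T = pttk_T r A d d\<^sub>\<theta> N\<^sub>t y"
  shows "\<exists>\<theta>\<^sub>m\<in>\<Theta>.
      (\<forall>\<theta>\<in>\<Theta>. mat_norm_C (K \<theta> - S * H \<theta> * transpose_mat T)
             \<le> mat_norm_C (K \<theta>\<^sub>m - S * H \<theta>\<^sub>m * transpose_mat T)) \<and>
      mat_norm_C (K \<theta>\<^sub>m - S * H \<theta>\<^sub>m * transpose_mat T)
        \<le> cheb_err D \<alpha> \<beta> C\<^sub>f \<gamma>\<^sub>f \<sigma> n
          + lebesgue_const (n - 1) ^ D * tensor_norm_C D n (\<lambda>idx. M idx - M' idx)"
proof -
  define w where "w j i t = cheb_basis n \<zeta> (\<alpha> j) (\<beta> j) i t" for j i t
  define \<xi> where "\<xi> = (\<lambda>ab \<theta>. concat_points d d\<^sub>\<theta> (x (fst ab)) \<theta> (y (snd ab)))"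
  define F where "F \<eta> = (\<Sum>idx\<in>{1..D} \<rightarrow>\<^sub>E {1..n}. (\<Prod>j=1..D. w j (idx j) (\<eta> j)) * M' idx)" for \<eta>
  define I where "I = {..<N\<^sub>s} \<times> {..<N\<^sub>t}"
  define bnd where "bnd = cheb_err D \<alpha> \<beta> C\<^sub>f \<gamma>\<^sub>f \<sigma> n
          + lebesgue_const (n - 1) ^ D * tensor_norm_C D n (\<lambda>idx. M idx - M' idx)"
  have D1: "D \<ge> 1" using \<open>d \<ge> 1\<close> D by simp
  have finI: "finite I" by (simp add: I_def)
  have \<xi>: "\<xi> ab \<theta> \<in> box_on D \<alpha> \<beta>" if "ab \<in> I" "\<theta> \<in> \<Theta>" for ab \<theta>
    using that X Y unfolding \<xi>_def D I_def Bs Theta Bt by (intro concat_points_in_box_on) auto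
  \<comment> \<open>On \<open>\<Theta>\<close> the matrix norm becomes a finite maximum of the
    scalar function \<open>f - F\<close> at points of the box; both continuity and the estimate are
    carried out in this form.\<close>
  have norm: "mat_norm_C (K \<theta> - S * H \<theta> * transpose_mat T) = max_abs I (\<lambda>ab. f (\<xi> ab \<theta>) - F (\<xi> ab \<theta>))"
    if \<theta>: "\<theta> \<in> \<Theta>" for \<theta>
  proof -
    have dims: "dim_row (S * H \<theta> * transpose_mat T) = N\<^sub>s" "dim_col (S * H \<theta> * transpose_mat T) = N\<^sub>t"
      by (simp_all add: S T pttk_S_def pttk_T_def)
    have "(K \<theta> - S * H \<theta> * transpose_mat T) $$ ab = f (\<xi> ab \<theta>) - F (\<xi> ab \<theta>)" if ab: "ab \<in> I" for ab
    proof -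
      obtain a b where ab': "ab = (a, b)" "a < N\<^sub>s" "b < N\<^sub>t" using ab by (auto simp: I_def)
      have "f (\<xi> ab \<theta>) = K \<theta> $$ ab"
        using ab' X[of a] Y[of b] \<theta> unfolding f \<xi>_def K kernel_mat_def Bs Bt Theta
        by (simp add: kernel_fun_concat_points)
      moreover have "(S * H \<theta> * transpose_mat T) $$ ab = F (\<xi> ab \<theta>)"
        using pttk_entry[OF cores[unfolded D] ab'(2,3) A, of x \<theta> y]
        unfolding S H T F_def \<xi>_def w_def M' D ab' by simp
      ultimately show ?thesis using ab' dims by simp
    qed
    then show ?thesis
      using dims unfolding mat_norm_C_def by (auto simp: I_def intro!: max_abs_cong)
  qed
  have "continuous_on \<Theta> (\<lambda>\<theta>. max_abs I (\<lambda>ab. f (\<xi> ab \<theta>) - F (\<xi> ab \<theta>)))"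
  proof (rule continuous_on_max_abs[OF finI])
    fix ab assume ab: "ab \<in> I"
    have c: "continuous_on \<Theta> (\<xi> ab)" unfolding \<xi>_def by (rule continuous_on_concat_points)
    have im: "\<xi> ab ` \<Theta> \<subseteq> box_on D \<alpha> \<beta>" using \<xi>[OF ab] by blast
    \<comment> \<open>The empty list of coordinates in \<open>smooth_on_box\<close> stands for
      \<open>f\<close> itself.\<close>
    have "continuous_on (box_on D \<alpha> \<beta>) f"
      using smooth unfolding smooth_on_box_def by (elim allE[of _ "[]"]) simp
    then have "continuous_on \<Theta> (\<lambda>\<theta>. f (\<xi> ab \<theta>))" by (rule continuous_on_compose2[OF _ c im])
    moreover have "continuous_on \<Theta> (\<lambda>\<theta>. w j i (\<xi> ab \<theta> j))" if "j \<in> {1..D}" for j i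
      unfolding w_def
      by (rule continuous_on_box_coordinate[OF c im that cheb_basis_continuous[OF intervals[OF that]]])
    then have "continuous_on \<Theta> (\<lambda>\<theta>. F (\<xi> ab \<theta>))"
      unfolding F_def by (intro continuous_intros) auto
    ultimately show "continuous_on \<Theta> (\<lambda>\<theta>. f (\<xi> ab \<theta>) - F (\<xi> ab \<theta>))" by (rule continuous_on_diff)
  qed
  moreover have "compact \<Theta>" unfolding Theta by (rule compact_box_on)
  moreover have "\<Theta> \<noteq> {}"
    unfolding Theta using intervals D by (intro box_on_nonempty less_imp_le) auto
  ultimately obtain \<theta>\<^sub>m where \<theta>\<^sub>m: "\<theta>\<^sub>m \<in> \<Theta>"
    "\<And>\<theta>. \<theta> \<in> \<Theta> \<Longrightarrow> max_abs I (\<lambda>ab. f (\<xi> ab \<theta>) - F (\<xi> ab \<theta>)) \<le> max_abs I (\<lambda>ab. f (\<xi> ab \<theta>\<^sub>m) - F (\<xi> ab \<theta>\<^sub>m))"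
    using continuous_attains_sup[of \<Theta> "\<lambda>\<theta>. max_abs I (\<lambda>ab. f (\<xi> ab \<theta>) - F (\<xi> ab \<theta>))"] by blast
  \<comment> \<open>The interpolant with the exact coefficients \<open>M\<close> is inserted between
    \<open>f\<close> and \<open>F\<close>: one part is the interpolation error, the other the
    interpolant of \<open>M - M'\<close>.\<close>
  have err: "\<bar>f \<eta> - F \<eta>\<bar> \<le> bnd" if \<eta>: "\<eta> \<in> box_on D \<alpha> \<beta>" for \<eta>
  proof -
    define P where "P idx = (\<Prod>j=1..D. w j (idx j) (\<eta> j))" for idx
    have "f \<eta> - F \<eta> = (f \<eta> - (\<Sum>idx\<in>{1..D} \<rightarrow>\<^sub>E {1..n}. P idx * M idx))
        + (\<Sum>idx\<in>{1..D} \<rightarrow>\<^sub>E {1..n}. P idx * (M idx - M' idx))"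
      by (simp add: F_def P_def right_diff_distrib sum_subtractf)
    moreover have "\<bar>f \<eta> - (\<Sum>idx\<in>{1..D} \<rightarrow>\<^sub>E {1..n}. P idx * M idx)\<bar> \<le> cheb_err D \<alpha> \<beta> C\<^sub>f \<gamma>\<^sub>f \<sigma> n"
      unfolding P_def w_def M
      by (rule chebyshev_tensor_interpolation_error[OF \<open>n \<ge> 1\<close> \<open>C\<^sub>f \<ge> 0\<close> \<open>\<gamma>\<^sub>f > 0\<close> \<open>\<sigma> \<ge> 1\<close>
          intervals smooth bound[unfolded Xi] nodes D1 \<eta>])
    moreover have "\<bar>\<Sum>idx\<in>{1..D} \<rightarrow>\<^sub>E {1..n}. P idx * (M idx - M' idx)\<bar>
        \<le> lebesgue_const (n - 1) ^ D * tensor_norm_C D n (\<lambda>idx. M idx - M' idx)"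
      unfolding P_def w_def by (rule weighted_tensor_bound[OF \<open>n \<ge> 1\<close> intervals nodes \<eta>])
    ultimately show ?thesis unfolding bnd_def by linarith
  qed
  \<comment> \<open>For an empty set of matrix entries the norm is the default 0 of
    \<open>max_abs\<close>, so \<open>bnd\<close> has to be nonnegative. The error estimate at any
    point of the box shows this.\<close>
  have "box_on D \<alpha> \<beta> \<noteq> {}" using intervals by (intro box_on_nonempty less_imp_le)
  then obtain \<eta> where "\<eta> \<in> box_on D \<alpha> \<beta>" by blast
  then have "0 \<le> bnd" by (rule order_trans[OF abs_ge_zero err])
  then have "max_abs I (\<lambda>ab. f (\<xi> ab \<theta>\<^sub>m) - F (\<xi> ab \<theta>\<^sub>m)) \<le> bnd"
    using err \<xi> \<theta>\<^sub>m(1) by (intro max_abs_le finI) auto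
  then show ?thesis
    using \<theta>\<^sub>m unfolding bnd_def by (intro bexI[of _ \<theta>\<^sub>m]) (auto simp: norm)
qed

end
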